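(* Let $U$ be a sunshine graph and $T$ a caterpillar, both of order $n$, with $b(U,T)\ge 5$. Let $U^+$ be a supercard of $U$ and $T$ that is a sunshine graph (with its chosen vertices $w,v$ and labelling as described in the context) which has the largest possible value of $\chi(U^+)$ over all supercards of $U$ and $T$ that are sunshine graphs. Then $b(U,T) \le 2\chi(U^+)+5$.
   Context: All graphs are finite and simple. For a graph $G$ and $v\in V(G)$, $G-v$ is obtained by deleting $v$ and its incident edges; the deck of $G$ is the multiset of unlabelled cards $G-v$; $b(G,H)$ is the cardinality of the multiset intersection of the decks of $G$ and $H$. A leaf is a vertex of degree 1; the skeleton of a graph is obtained by deleting all leaves and isolated vertices; a sunshine graph is a connected graph whose skeleton is a cycle; a caterpillar is a connected graph whose skeleton is a path. A supercard of $U$ and $T$ is a graph of order $n+1$ whose deck contains a card isomorphic to $U$ and a card isomorphic to $T$. For a sunshine supercard $U^+$, fix vertices $w,v$ with $U^+-w\cong U$ and $U^+-v\cong T$ (then $w$ is a leaf and $v$ is a degree-2 vertex of the cycle); identify $U$ with $U^+-w$ and $T$ with $U^+-v$. Label the cycle $x_0x_1\ldots x_{c-1}x_0$ (indices mod $c$) with $x_0$ the neighbour of $w$, $v=x_\nu$, and $d_{U^+}(x_{\nu-1})\ge d_{U^+}(x_{\nu+1})$. For a bijection $\lambda$ and graphs $G,H$ with $\lambda(V(G))=V(H)$, write $\lambda(G)=H$ if $\lambda$ is an isomorphism from $G$ to $H$. Let $B_{vw}(U^+)=\{\lambda\in \mathrm{Sym}(V(U^+)) : \lambda(U-\lambda^{-1}(v))=T-\lambda(w)\}$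 and $B_U=\{\lambda\in B_{vw}(U^+): \lambda(U)=U^+-\lambda(w)\}$. A maximum saturating set is a set $X\subseteq B_{vw}(U^+)$ such that (1) the identity is in $X$; (2) any distinct $\lambda,\pi\in X$ satisfy $\lambda^{-1}(v)\ne\pi^{-1}(v)$ and $\lambda(w)\ne\pi(w)$; (3) there is no $\sigma\in B_{vw}(U^+)\setminus X$ such that $X\cup\{\sigma\}$ satisfies (2). Let $X_U=X\cap B_U$, and let $\chi(U^+)$ be the maximum of $|X_U|$ over all maximum saturating sets $X$. *)

theory Defs
  imports "Graph_Theory.Graph_Theory" "HOL-Library.Multiset"
begin

text \<open>
  A finite simple graph is a \<^locale>\<open>pair_graph\<close>: a finite vertex set together with a symmetric,
  irreflexive set of pairs, the edge between \<open>x\<close> and \<open>y\<close> being represented by the two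
  pairs \<open>(x, y)\<close> and \<open>(y, x)\<close>.
\<close>

type_synonym 'a ugraph = "'a pair_pre_digraph"

abbreviation degree :: "'a ugraph \<Rightarrow> 'a \<Rightarrow> nat" where
  "degree G x \<equiv> out_degree (with_proj G) x"

abbreviation connected_graph :: "'a ugraph \<Rightarrow> bool" where
  "connected_graph G \<equiv> Digraph_Component.connected (with_proj G)"

abbreviation isomorphic :: "'a ugraph \<Rightarrow> 'b ugraph \<Rightarrow> bool" where
  "isomorphic G H \<equiv> digraph_iso (with_proj G) (with_proj H)"

definition is_isomorphism :: "('a \<Rightarrow> 'b) \<Rightarrow> 'a ugraph \<Rightarrow> 'b ugraph \<Rightarrow> bool" where
  "is_isomorphism f G H \<longleftrightarrow>
     bij_betw f (pverts G) (pverts H) \<and>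
     (\<forall>x \<in> pverts G. \<forall>y \<in> pverts G. (x, y) \<in> parcs G \<longleftrightarrow> (f x, f y) \<in> parcs H)"

definition induced :: "'a ugraph \<Rightarrow> 'a set \<Rightarrow> 'a ugraph" where
  "induced G S = \<lparr> pverts = S, parcs = {e \<in> parcs G. fst e \<in> S \<and> snd e \<in> S} \<rparr>"

definition del :: "'a ugraph \<Rightarrow> 'a \<Rightarrow> 'a ugraph" (infixl \<open>\<ominus>\<close> 65) where
  "G \<ominus> x = induced G (pverts G - {x})"

lemma with_proj_induced: "with_proj (induced G S) = with_proj G \<restriction> S"
  by (simp add: with_proj_def induced_def induce_subgraph_def)

lemma with_proj_del:
  assumes "pair_wf_digraph G"
  shows "with_proj (G \<ominus> x) = pre_digraph.del_vert (with_proj G) x"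
proof -
  interpret pair_wf_digraph G by fact
  have "{e \<in> parcs G. fst e \<in> pverts G - {x} \<and> snd e \<in> pverts G - {x}} =
        {e \<in> parcs G. fst e \<noteq> x \<and> snd e \<noteq> x}"
    using arc_fst_in_verts arc_snd_in_verts by blast
  then show ?thesis
    by (simp add: with_proj_def del_def induced_def pre_digraph.del_vert_def)
qed

lemma isomorphic_iff:
  assumes "pair_wf_digraph G" "pair_wf_digraph H"
  shows "isomorphic G H \<longleftrightarrow> (\<exists>f. is_isomorphism f G H)"
proof
  interpret G: pair_wf_digraph G by fact
  interpret H: pair_wf_digraph H by fact
  {
    assume "isomorphic G H"
    then obtain h where h: "pre_digraph.digraph_isomorphism (with_proj G) h"
        and H: "with_proj H = app_iso h (with_proj G)"
      unfolding digraph_iso_def by blast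
    let ?f = "iso_verts h"
    have pv: "pverts H = ?f ` pverts G" and pa: "parcs H = iso_arcs h ` parcs G"
      and tl: "iso_tail h = fst" and hd: "iso_head h = snd"
      using H by (simp_all add: with_proj_def app_iso_def)
    have inj: "inj_on ?f (pverts G)"
      using h by (simp add: pre_digraph.digraph_isomorphism_def)
    have ia: "iso_arcs h e = (?f (fst e), ?f (snd e))" if "e \<in> parcs G" for e
      using h that by (simp add: pre_digraph.digraph_isomorphism_def tl hd prod_eq_iff)
    have "(x, y) \<in> parcs G \<longleftrightarrow> (?f x, ?f y) \<in> parcs H"
      if "x \<in> pverts G" "y \<in> pverts G" for x y
    proof
      assume "(x, y) \<in> parcs G"
      then show "(?f x, ?f y) \<in> parcs H"
        unfolding pa using ia by (metis fst_conv image_eqI snd_conv)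
    next
      assume "(?f x, ?f y) \<in> parcs H"
      then obtain e where e: "e \<in> parcs G" "iso_arcs h e = (?f x, ?f y)"
        unfolding pa by force
      then have "fst e = x" "snd e = y"
        using ia[OF e(1)] inj that G.arc_fst_in_verts G.arc_snd_in_verts
        by (auto dest: inj_onD)
      with e show "(x, y) \<in> parcs G" by (metis prod.collapse)
    qed
    then show "\<exists>f. is_isomorphism f G H"
      using inj pv unfolding is_isomorphism_def bij_betw_def by blast
  }
  {
    assume "\<exists>f. is_isomorphism f G H"
    then obtain f where inj: "inj_on f (pverts G)" and pv: "f ` pverts G = pverts H"
      and ar: "\<forall>x \<in> pverts G. \<forall>y \<in> pverts G. (x, y) \<in> parcs G \<longleftrightarrow> (f x, f y) \<in> parcs H"
      unfolding is_isomorphism_def bij_betw_def by blast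
    let ?h = "\<lparr> iso_verts = f, iso_arcs = map_prod f f, iso_head = snd, iso_tail = fst \<rparr>"
    have sub: "parcs G \<subseteq> pverts G \<times> pverts G"
      using G.in_arcsD1 G.in_arcsD2 by (intro subrelI) blast
    have "inj_on (map_prod f f) (parcs G)"
      using inj_on_subset[OF map_prod_inj_on[OF inj inj] sub] .
    then have 1: "pre_digraph.digraph_isomorphism (with_proj G) ?h"
      using inj G.wf_digraph_axioms by (auto simp: pre_digraph.digraph_isomorphism_def)
    have "parcs H = map_prod f f ` parcs G"
    proof (intro equalityI subsetI)
      fix e assume e: "e \<in> parcs H"
      then have "fst e \<in> f ` pverts G" "snd e \<in> f ` pverts G"
        using pv H.arc_fst_in_verts H.arc_snd_in_verts by auto
      then obtain x y where xy: "x \<in> pverts G" "y \<in> pverts G" "e = (f x, f y)"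
        by (metis imageE prod.collapse)
      with ar e have "(x, y) \<in> parcs G" by blast
      with xy show "e \<in> map_prod f f ` parcs G" by force
    next
      fix e assume "e \<in> map_prod f f ` parcs G"
      then obtain x y where "(x, y) \<in> parcs G" "e = (f x, f y)" by auto
      then show "e \<in> parcs H" using ar G.in_arcsD1 G.in_arcsD2 by blast
    qed
    then have "with_proj H = app_iso ?h (with_proj G)"
      using pv by (simp add: with_proj_def app_iso_def)
    with 1 show "isomorphic G H" unfolding digraph_iso_def by blast
  }
qed

text \<open>
  An unlabelled graph is an isomorphism class. Every finite graph has an isomorphic copy on
  natural numbers, so these classes allow graphs over different vertex types to be compared.
\<close>

definition unlabelled :: "'a ugraph \<Rightarrow> nat ugraph set" where
  "unlabelled G = {H. isomorphic G H}"

definition deck :: "'a ugraph \<Rightarrow> nat ugraph set multiset" where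
  "deck G = image_mset (\<lambda>x. unlabelled (G \<ominus> x)) (mset_set (pverts G))"

definition common_cards :: "'a ugraph \<Rightarrow> 'b ugraph \<Rightarrow> nat" where
  "common_cards G H = size (deck G \<inter># deck H)"

definition skeleton :: "'a ugraph \<Rightarrow> 'a ugraph" where
  "skeleton G = induced G {x \<in> pverts G. degree G x \<noteq> 0 \<and> degree G x \<noteq> 1}"

definition cycle_labelling :: "'a ugraph \<Rightarrow> nat \<Rightarrow> (nat \<Rightarrow> 'a) \<Rightarrow> bool" where
  "cycle_labelling G c x \<longleftrightarrow>
     3 \<le> c \<and> bij_betw x {..<c} (pverts G) \<and>
     parcs G = {(x i, x j) | i j. i < c \<and> j < c \<and> (j = (i + 1) mod c \<or> i = (j + 1) mod c)}"

definition path_labelling :: "'a ugraph \<Rightarrow> nat \<Rightarrow> (nat \<Rightarrow> 'a) \<Rightarrow> bool" where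
  "path_labelling G m x \<longleftrightarrow>
     1 \<le> m \<and> bij_betw x {..<m} (pverts G) \<and>
     parcs G = {(x i, x j) | i j. i < m \<and> j < m \<and> (j = i + 1 \<or> i = j + 1)}"

definition is_cycle :: "'a ugraph \<Rightarrow> bool" where
  "is_cycle G \<longleftrightarrow> (\<exists>c x. cycle_labelling G c x)"

definition is_path :: "'a ugraph \<Rightarrow> bool" where
  "is_path G \<longleftrightarrow> (\<exists>m x. path_labelling G m x)"

definition sunshine :: "'a ugraph \<Rightarrow> bool" where
  "sunshine G \<longleftrightarrow> pair_graph G \<and> connected_graph G \<and> is_cycle (skeleton G)"

definition caterpillar :: "'a ugraph \<Rightarrow> bool" where
  "caterpillar G \<longleftrightarrow> pair_graph G \<and> connected_graph G \<and> is_path (skeleton G)"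

definition supercard :: "nat \<Rightarrow> 'a ugraph \<Rightarrow> 'b ugraph \<Rightarrow> 'c ugraph \<Rightarrow> bool" where
  "supercard n U T G \<longleftrightarrow>
     pair_graph G \<and> card (pverts G) = n + 1 \<and>
     unlabelled U \<in># deck G \<and> unlabelled T \<in># deck G"

text \<open>
  A sunshine supercard \<open>G\<close> of \<open>U\<close> and \<open>T\<close> together with its chosen vertices \<open>w\<close>, \<open>v\<close> and its
  labelled cycle \<open>x 0, \<dots>, x (c - 1)\<close>. The cycle of \<open>G\<close> is its skeleton, and the two
  degrees compared are those of the neighbours of \<open>v = x \<nu>\<close> on it.
\<close>

definition marked_sunshine_supercard ::
  "nat \<Rightarrow> 'a ugraph \<Rightarrow> 'b ugraph \<Rightarrow> 'c ugraph \<Rightarrow> 'c \<Rightarrow> 'c \<Rightarrow> nat \<Rightarrow> (nat \<Rightarrow> 'c) \<Rightarrow> nat \<Rightarrow> bool"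
where
  "marked_sunshine_supercard n U T G w v c x \<nu> \<longleftrightarrow>
     supercard n U T G \<and> sunshine G \<and>
     w \<in> pverts G \<and> isomorphic (G \<ominus> w) U \<and>
     v \<in> pverts G \<and> isomorphic (G \<ominus> v) T \<and>
     cycle_labelling (skeleton G) c x \<and>
     (x 0, w) \<in> parcs G \<and>
     \<nu> < c \<and> v = x \<nu> \<and>
     degree G (x ((\<nu> + c - 1) mod c)) \<ge> degree G (x ((\<nu> + 1) mod c))"

text \<open>
  In the following, \<open>U\<close> and \<open>T\<close> are identified with \<open>G \<ominus> w\<close> and \<open>G \<ominus> v\<close>. If \<open>f w = v\<close>,
  the second deletion on either side in \<open>B_vw\<close> removes nothing, so that \<open>f\<close> would have to be an isomorphism
  from \<open>U\<close> to \<open>T\<close>; this is impossible when \<open>U\<close> is a sunshine graph and \<open>T\<close> a caterpillar.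
\<close>

definition B_vw :: "'a ugraph \<Rightarrow> 'a \<Rightarrow> 'a \<Rightarrow> ('a \<Rightarrow> 'a) set" where
  "B_vw G w v =
     {f. f permutes pverts G \<and> is_isomorphism f ((G \<ominus> w) \<ominus> inv f v) ((G \<ominus> v) \<ominus> f w)}"

definition B_U :: "'a ugraph \<Rightarrow> 'a \<Rightarrow> 'a \<Rightarrow> ('a \<Rightarrow> 'a) set" where
  "B_U G w v = {f \<in> B_vw G w v. is_isomorphism f (G \<ominus> w) (G \<ominus> f w)}"

definition saturating :: "'a \<Rightarrow> 'a \<Rightarrow> ('a \<Rightarrow> 'a) set \<Rightarrow> bool" where
  "saturating w v X \<longleftrightarrow> (\<forall>f \<in> X. \<forall>g \<in> X. f \<noteq> g \<longrightarrow> inv f v \<noteq> inv g v \<and> f w \<noteq> g w)"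

definition max_saturating :: "'a ugraph \<Rightarrow> 'a \<Rightarrow> 'a \<Rightarrow> ('a \<Rightarrow> 'a) set \<Rightarrow> bool" where
  "max_saturating G w v X \<longleftrightarrow>
     X \<subseteq> B_vw G w v \<and> id \<in> X \<and> saturating w v X \<and>
     \<not> (\<exists>s \<in> B_vw G w v - X. saturating w v (insert s X))"

definition chi :: "'a ugraph \<Rightarrow> 'a \<Rightarrow> 'a \<Rightarrow> nat" where
  "chi G w v = Max {card (X \<inter> B_U G w v) | X. max_saturating G w v X}"

end

theory Submission
  imports Defs
begin

text \<open>
  Let \<open>p\<^sub>0, \<dots>, p\<^sub>k\<^sub>+\<^sub>1\<close> be a longest path of \<open>T\<close>, so that its inner vertices form the skeleton, and let
  \<open>c\<close> be the length of the cycle of \<open>U\<close>. If \<open>U - a \<cong> T - b\<close> and \<open>b\<close> is none of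
  \<open>p\<^sub>0, p\<^sub>1, p\<^sub>k, p\<^sub>k\<^sub>+\<^sub>1\<close>, then \<open>b\<close> is a leaf, \<open>a\<close> lies on the cycle and has degree \<open>2\<close>, and the
  rest of the cycle is mapped to a path of \<open>c - 1\<close> vertices that contains the skeleton of \<open>T\<close>.
  Permuting leaves with a common neighbour, we may assume that this path is
  \<open>p\<^sub>1\<^sub>-\<^sub>i, \<dots>, p\<^sub>c\<^sub>-\<^sub>1\<^sub>-\<^sub>i\<close> for some \<open>i \<in> {0, 1}\<close>. Let \<open>G\<^sub>i\<close> be \<open>T\<close> together with a new vertex \<open>v\<close>
  joined to the two ends of that path. Every isomorphism of class \<open>i\<close>, extended by \<open>a \<mapsto> v\<close>,
  identifies \<open>U\<close> with \<open>G\<^sub>i - b\<close>. Hence \<open>G\<^sub>i\<close> is a sunshine supercard as soon as its class is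
  nonempty, and all pairs of its class count towards \<open>\<chi>(G\<^sub>i)\<close>. At most four pairs of a
  maximum matching of the decks are excluded, so the larger class contains at least half of
  the remaining \<open>b(U, T) - 4\<close> pairs.
\<close>

section \<open>Matchings of equal cards\<close>

text \<open>The value of \<open>a\<close> also occurs on \<open>B\<close>; pairing \<open>a\<close>
  with a vertex \<open>b\<close> of that value and removing both keeps the two image multisets
  equal.\<close>

lemma image_mset_eq_bij_betw:
  assumes "finite A" "finite B"
    and "image_mset f (mset_set A) = image_mset g (mset_set B)"
  shows "\<exists>h. bij_betw h A B \<and> (\<forall>a\<in>A. g (h a) = f a)"
  using assms
proof (induction A arbitrary: B rule: finite_induct)
  case empty
  then have "mset_set B = {#}" by simp
  then have "B = {}" using empty.prems(1) by (simp add: mset_set_empty_iff)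
  then show ?case by (auto simp: bij_betw_def)
next
  case (insert a A)
  have "f a \<in># image_mset f (mset_set (insert a A))" using insert.hyps by simp
  then have "f a \<in># image_mset g (mset_set B)" using insert.prems by simp
  then obtain b where b: "b \<in> B" "g b = f a" using insert.prems by auto
  have B: "mset_set B = add_mset b (mset_set (B - {b}))"
    using mset_set.remove[OF insert.prems(1) b(1)] .
  have "image_mset f (mset_set A) = image_mset g (mset_set (B - {b}))"
    using insert.prems insert.hyps b by (simp add: B)
  with insert.IH[of "B - {b}"] insert.prems obtain h
    where h: "bij_betw h A (B - {b})" "\<forall>x\<in>A. g (h x) = f x" by auto
  have "bij_betw (h(a := b)) A (B - {b})"
    using h(1) insert.hyps(2) by (subst bij_betw_cong[where g = h]) auto
  then have "bij_betw (h(a := b)) (A \<union> {a}) (B - {b} \<union> {b})"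
    using insert.hyps(2) notIn_Un_bij_betw[of a A "h(a := b)" "B - {b}"] by (simp del: Un_insert_right)
  then have "bij_betw (h(a := b)) (insert a A) B" using b(1) by (simp add: insert_absorb)
  moreover have "\<forall>x\<in>insert a A. g ((h(a := b)) x) = f x" using h b insert.hyps by auto
  ultimately show ?case by blast
qed

lemma subseteq_image_mset_set:
  assumes "finite A" "M \<subseteq># image_mset f (mset_set A)"
  shows "\<exists>S\<subseteq>A. M = image_mset f (mset_set S)"
  using assms
proof (induction A arbitrary: M rule: finite_induct)
  case empty
  then show ?case by auto
next
  case (insert a A)
  show ?case
  proof (cases "f a \<in># M")
    case True
    then obtain N where N: "M = add_mset (f a) N" by (metis mset_add)
    with insert have "N \<subseteq># image_mset f (mset_set A)" by simp
    with insert.IH obtain S where S: "S \<subseteq> A" "N = image_mset f (mset_set S)" by blast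
    have "M = image_mset f (mset_set (insert a S))"
      using N S insert.hyps finite_subset[OF S(1)] by (subst mset_set.insert) auto
    with S show ?thesis by blast
  next
    case False
    have "M \<subseteq># image_mset f (mset_set A) + {#f a#}" using insert.prems insert.hyps by simp
    then have "M - {#f a#} \<subseteq># image_mset f (mset_set A)" by (simp add: subset_eq_diff_conv)
    with False have "M \<subseteq># image_mset f (mset_set A)" by (simp add: diff_single_trivial)
    with insert.IH show ?thesis by blast
  qed
qed

text \<open>The intersection is a submultiset of both images, so it lifts to a subset of either
  domain, and these two subsets are matched because their images agree. This turns the number of
  common cards into an injection between vertices.\<close>

lemma size_inter_image_mset_matching:
  assumes "finite A" "finite B"
  shows "\<exists>S h. S \<subseteq> A \<and> inj_on h S \<and> h ` S \<subseteq> B \<and> (\<forall>a\<in>S. g (h a) = f a) \<and>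
    card S = size (image_mset f (mset_set A) \<inter># image_mset g (mset_set B))"
proof -
  let ?M = "image_mset f (mset_set A) \<inter># image_mset g (mset_set B)"
  obtain S where S: "S \<subseteq> A" "?M = image_mset f (mset_set S)"
    using subseteq_image_mset_set[OF assms(1), of ?M f] by auto
  obtain R where R: "R \<subseteq> B" "?M = image_mset g (mset_set R)"
    using subseteq_image_mset_set[OF assms(2), of ?M g] by auto
  have "image_mset f (mset_set S) = image_mset g (mset_set R)"
    using S(2) R(2) by simp
  then obtain h where "bij_betw h S R" "\<forall>a\<in>S. g (h a) = f a"
    using image_mset_eq_bij_betw[of S R f g] finite_subset[OF S(1)] finite_subset[OF R(1)] assms
    by blast
  moreover have "card S = size ?M" using S by simp
  ultimately show ?thesis using S(1) R(1) by (intro exI[of _ S] exI[of _ h]) (auto simp: bij_betw_def)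
qed

section \<open>Finite simple graphs: deletion, isomorphism and unlabelled cards\<close>

lemma pair_graph_iff:
  "pair_graph G \<longleftrightarrow> finite (pverts G) \<and>
     (\<forall>x y. (x, y) \<in> parcs G \<longrightarrow> x \<in> pverts G \<and> y \<noteq> x \<and> (y, x) \<in> parcs G)"
  (is "?L \<longleftrightarrow> ?R")
proof
  assume ?L
  then interpret pair_graph G .
  have "(y, x) \<in> parcs G" if "(x, y) \<in> parcs G" for x y
    using pair_sym_arcs that by (simp add: symmetric_def sym_def)
  then show ?R
    using pair_finite_verts in_arcsD1 pair_no_loops by force
next
  assume R: ?R
  then have "parcs G \<subseteq> pverts G \<times> pverts G" by auto
  then have "finite (parcs G)" using R by (auto intro: finite_subset)
  with R show ?L
    by unfold_locales (auto simp: symmetric_def sym_def, blast)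
qed

lemma pair_graph_parcsD:
  assumes "pair_graph G" "(x, y) \<in> parcs G"
  shows "x \<in> pverts G" "y \<in> pverts G" "(y, x) \<in> parcs G" "x \<noteq> y"
  using assms unfolding pair_graph_iff by blast+

lemma pverts_del [simp]: "pverts (G \<ominus> x) = pverts G - {x}"
  by (simp add: del_def induced_def)

lemma parcs_del [simp]:
  "(y, z) \<in> parcs (G \<ominus> x) \<longleftrightarrow>
     (y, z) \<in> parcs G \<and> y \<in> pverts G \<and> z \<in> pverts G \<and> y \<noteq> x \<and> z \<noteq> x"
  by (auto simp: del_def induced_def)

lemma pverts_induced [simp]: "pverts (induced G S) = S"
  by (simp add: induced_def)

lemma parcs_induced [simp]: "(y, z) \<in> parcs (induced G S) \<longleftrightarrow> (y, z) \<in> parcs G \<and> y \<in> S \<and> z \<in> S"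
  by (auto simp: induced_def)

lemma pair_graph_del: "pair_graph G \<Longrightarrow> pair_graph (G \<ominus> x)"
  by (auto simp: pair_graph_iff)

lemma pair_graph_wf: "pair_graph G \<Longrightarrow> pair_wf_digraph G"
  by (simp add: pair_graph_def pair_digraph_def pair_fin_digraph_def)

lemma del_commute: "(G \<ominus> x) \<ominus> y = (G \<ominus> y) \<ominus> x"
  by (auto simp: del_def induced_def)

lemma is_isomorphism_id: "is_isomorphism id G G"
  by (simp add: is_isomorphism_def)

lemma is_isomorphism_comp:
  assumes "is_isomorphism f G H" "is_isomorphism g H K"
  shows "is_isomorphism (g \<circ> f) G K"
  using assms bij_betw_trans[of f "pverts G" "pverts H" g "pverts K"]
  by (auto simp: is_isomorphism_def bij_betw_apply)

lemma is_isomorphism_inv_into: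
  assumes "is_isomorphism f G H"
  shows "is_isomorphism (inv_into (pverts G) f) H G"
  unfolding is_isomorphism_def
proof (intro conjI ballI)
  have b: "bij_betw f (pverts G) (pverts H)" using assms by (simp add: is_isomorphism_def)
  then show "bij_betw (inv_into (pverts G) f) (pverts H) (pverts G)" by (rule bij_betw_inv_into)
  fix x y assume "x \<in> pverts H" "y \<in> pverts H"
  then show "(x, y) \<in> parcs H \<longleftrightarrow> (inv_into (pverts G) f x, inv_into (pverts G) f y) \<in> parcs G"
    using assms bij_betw_inv_into[OF b] bij_betw_inv_into_right[OF b]
    by (auto simp: is_isomorphism_def bij_betw_apply)
qed

lemma is_isomorphism_cong:
  assumes "\<And>x. x \<in> pverts G \<Longrightarrow> f x = g x"
  shows "is_isomorphism f G H \<longleftrightarrow> is_isomorphism g G H"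
  using assms bij_betw_cong[of "pverts G" f g] by (simp add: is_isomorphism_def)

lemma is_isomorphism_del:
  assumes "is_isomorphism f G H" "x \<in> pverts G"
  shows "is_isomorphism f (G \<ominus> x) (H \<ominus> f x)"
proof -
  have "inj_on f (pverts G)" "f ` pverts G = pverts H"
    using assms by (auto simp: is_isomorphism_def bij_betw_def)
  then have "bij_betw f (pverts G - {x}) (pverts H - {f x})"
    using assms(2) by (auto simp: bij_betw_def inj_on_def)
  moreover have "f y \<noteq> f x" if "y \<in> pverts G - {x}" for y
    using that \<open>inj_on f (pverts G)\<close> assms(2) by (auto dest: inj_onD)
  ultimately show ?thesis
    using assms(1) by (auto simp: is_isomorphism_def bij_betw_def)
qed

text \<open>The map runs against the direction of \<open>isomorphic\<close>, since later maps lead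
  from \<open>U\<close> and \<open>T\<close> into a supercard whereas the definition of a marked
  supercard compares its cards with \<open>U\<close> and \<open>T\<close>.\<close>

lemma isomorphic_sym_iff:
  assumes "pair_graph G" "pair_graph H"
  shows "isomorphic G H \<longleftrightarrow> (\<exists>f. is_isomorphism f H G)"
  using isomorphic_iff[OF pair_graph_wf[OF assms(1)] pair_graph_wf[OF assms(2)]]
    is_isomorphism_inv_into by metis

lemma unlabelled_eqI:
  assumes "pair_wf_digraph G" "pair_wf_digraph H" "isomorphic G H"
  shows "unlabelled G = unlabelled H"
proof -
  interpret G: pair_wf_digraph G by fact
  have "isomorphic H G" using assms(3) G.wf_digraph_axioms digraph_iso_swap by blast
  then show ?thesis using assms(3) unfolding unlabelled_def by (auto intro: digraph_iso_trans)
qed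

text \<open>The classes contain only graphs on natural numbers. A copy \<open>?K\<close> of
  \<open>G\<close> on natural numbers lies in both classes and links \<open>G\<close> to
  \<open>H\<close>.\<close>

lemma unlabelled_eqD:
  assumes "pair_graph G" "pair_graph H" "unlabelled G = unlabelled H"
  shows "isomorphic G H"
proof -
  interpret H: pair_wf_digraph H using assms pair_graph_wf by blast
  obtain e :: "'a \<Rightarrow> nat" where e: "inj_on e (pverts G)"
    using assms(1) finite_imp_inj_to_nat_seg by (metis pair_graph_iff)
  let ?K = "\<lparr>pverts = e ` pverts G, parcs = map_prod e e ` parcs G\<rparr>"
  have Gv: "(x, y) \<in> parcs G \<Longrightarrow> x \<in> pverts G \<and> y \<in> pverts G" for x y
    using assms(1) by (metis pair_graph_iff)
  have "(x, y) \<in> parcs G \<longleftrightarrow> (e x, e y) \<in> map_prod e e ` parcs G"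
    if "x \<in> pverts G" "y \<in> pverts G" for x y
  proof
    assume "(e x, e y) \<in> map_prod e e ` parcs G"
    then obtain s t where st: "(s, t) \<in> parcs G" "e x = e s" "e y = e t" by auto
    with Gv that have "x = s" "y = t" using inj_onD[OF e] by blast+
    with st show "(x, y) \<in> parcs G" by simp
  qed force
  then have "is_isomorphism e G ?K" using e by (simp add: is_isomorphism_def bij_betw_def)
  moreover have "pair_wf_digraph ?K" using Gv by unfold_locales auto
  ultimately have "isomorphic G ?K" using isomorphic_iff[of G ?K] pair_graph_wf[OF assms(1)] by blast
  moreover from this have "isomorphic H ?K" using assms(3) by (auto simp: unlabelled_def)
  then have "isomorphic ?K H" using H.wf_digraph_axioms digraph_iso_swap by blast
  ultimately show ?thesis by (rule digraph_iso_trans)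
qed

lemma unlabelled_eq_iff:
  assumes "pair_graph G" "pair_graph H"
  shows "unlabelled G = unlabelled H \<longleftrightarrow> (\<exists>f. is_isomorphism f G H)"
  using unlabelled_eqI[of G H] unlabelled_eqD[of G H] isomorphic_iff[of G H]
    pair_graph_wf[OF assms(1)] pair_graph_wf[OF assms(2)] assms
  by metis

lemma common_cards_matching:
  assumes "pair_graph U" "pair_graph T"
  shows "\<exists>A h. A \<subseteq> pverts U \<and> inj_on h A \<and> h ` A \<subseteq> pverts T \<and>
    (\<forall>a\<in>A. \<exists>f. is_isomorphism f (U \<ominus> a) (T \<ominus> h a)) \<and> card A = common_cards U T"
proof -
  have "finite (pverts U)" "finite (pverts T)" using assms by (auto simp: pair_graph_iff)
  from size_inter_image_mset_matching[OF this, of "\<lambda>x. unlabelled (T \<ominus> x)" "\<lambda>x. unlabelled (U \<ominus> x)"]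
  obtain A h where A: "A \<subseteq> pverts U" "inj_on h A" "h ` A \<subseteq> pverts T" "card A = common_cards U T"
    "\<forall>a\<in>A. unlabelled (T \<ominus> h a) = unlabelled (U \<ominus> a)"
    unfolding common_cards_def deck_def by blast
  then have "\<forall>a\<in>A. \<exists>f. is_isomorphism f (U \<ominus> a) (T \<ominus> h a)"
    using unlabelled_eq_iff[OF pair_graph_del[OF assms(1)] pair_graph_del[OF assms(2)]] by metis
  with A show ?thesis by blast
qed

section \<open>Cycles and paths with pendant vertices\<close>

text \<open>In the applications \<open>S\<close> is the cycle of a sunshine graph or the skeleton of
  a caterpillar. Degrees are not mentioned, so the property can be checked before \<open>S\<close>
  is known to be the skeleton, and it is easily transported along isomorphisms.\<close>

definition pendants :: "'a ugraph \<Rightarrow> 'a set \<Rightarrow> bool" where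
  "pendants G S \<longleftrightarrow>
     S \<subseteq> pverts G \<and> (\<forall>x \<in> pverts G - S. \<exists>s\<in>S. \<forall>z. (x, z) \<in> parcs G \<longleftrightarrow> z = s)"

lemma pendants_leaf:
  assumes "pendants G S" "x \<in> pverts G" "x \<notin> S"
  obtains s where "s \<in> S" "\<And>z. (x, z) \<in> parcs G \<longleftrightarrow> z = s"
proof -
  have "x \<in> pverts G - S" using assms by simp
  then show thesis using assms(1) that unfolding pendants_def by blast
qed

section \<open>Degrees and connectedness\<close>

lemma degree_eq_card: "degree G x = card {z. (x, z) \<in> parcs G}"
proof -
  have "out_arcs (with_proj G) x = Pair x ` {z. (x, z) \<in> parcs G}"
    by (auto simp: out_arcs_def)
  then show ?thesis by (simp add: out_degree_def card_image inj_on_def)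
qed

lemma finite_neighbours: "pair_graph G \<Longrightarrow> finite {z. (x, z) \<in> parcs G}"
  by (rule finite_subset[of _ "pverts G"]) (auto simp: pair_graph_iff)

lemma degree_eq_1_iff: "degree G x = 1 \<longleftrightarrow> (\<exists>s. \<forall>z. (x, z) \<in> parcs G \<longleftrightarrow> z = s)"
proof -
  have "degree G x = 1 \<longleftrightarrow> (\<exists>s. {z. (x, z) \<in> parcs G} = {s})"
    by (simp add: degree_eq_card card_1_singleton_iff)
  then show ?thesis by (simp add: set_eq_iff)
qed

lemma two_le_degreeI:
  assumes "pair_graph G" "(x, y) \<in> parcs G" "(x, z) \<in> parcs G" "y \<noteq> z"
  shows "2 \<le> degree G x"
proof -
  have "card {y, z} \<le> degree G x"
    unfolding degree_eq_card using assms finite_neighbours[OF assms(1)] by (intro card_mono) auto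
  then show ?thesis using assms(4) by simp
qed

lemma two_le_degreeE:
  assumes "2 \<le> degree G x"
  obtains y z where "(x, y) \<in> parcs G" "(x, z) \<in> parcs G" "y \<noteq> z"
proof -
  have "{z. (x, z) \<in> parcs G} \<noteq> {}"
  proof
    assume "{z. (x, z) \<in> parcs G} = {}"
    with assms show False by (simp only: degree_eq_card) simp
  qed
  then obtain y where y: "(x, y) \<in> parcs G" by auto
  have "\<not> {z. (x, z) \<in> parcs G} \<subseteq> {y}"
  proof
    assume "{z. (x, z) \<in> parcs G} \<subseteq> {y}"
    then have "degree G x \<le> card {y}" unfolding degree_eq_card by (intro card_mono) auto
    with assms show False by simp
  qed
  with y that show thesis by auto
qed

text \<open>Reachability never leaves a set closed under adjacency. Connectedness is used only in
  this form and established only through the converse \<open>connected_graphI\<close>.\<close>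

lemma connected_graph_closed:
  assumes "pair_graph G" "connected_graph G" "x \<in> A" "x \<in> pverts G"
    and "\<And>y z. y \<in> A \<Longrightarrow> (y, z) \<in> parcs G \<Longrightarrow> z \<in> A"
  shows "pverts G \<subseteq> A"
proof
  fix u assume u: "u \<in> pverts G"
  interpret pair_graph G by fact
  have "strongly_connected (with_proj G)"
    using symmetric_connected_imp_strongly_connected assms(2) pair_sym_arcs by blast
  then have "x \<rightarrow>\<^sup>*\<^bsub>with_proj G\<^esub> u"
    using assms(4) u by (auto simp: strongly_connected_def)
  then show "u \<in> A"
    by (induction rule: reachable_induct) (use assms in auto)
qed

text \<open>The vertices reachable from \<open>x\<close> form such a closed set \<open>A\<close>; by
  symmetry any two vertices are then joined through \<open>x\<close>.\<close>

lemma connected_graphI: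
  assumes "pair_graph G" "x \<in> pverts G"
    and "\<And>A. x \<in> A \<Longrightarrow> (\<And>y z. y \<in> A \<Longrightarrow> (y, z) \<in> parcs G \<Longrightarrow> z \<in> A) \<Longrightarrow> pverts G \<subseteq> A"
  shows "connected_graph G"
proof -
  interpret pair_graph G by fact
  have reach: "x \<rightarrow>\<^sup>*\<^bsub>with_proj G\<^esub> u" if "u \<in> pverts G" for u
  proof -
    have "pverts G \<subseteq> {u. x \<rightarrow>\<^sup>*\<^bsub>with_proj G\<^esub> u}"
      using assms(2) by (intro assms(3)) (auto intro: reachable_adj_trans)
    with that show ?thesis by blast
  qed
  have "u \<rightarrow>\<^sup>*\<^bsub>with_proj G\<^esub> z" if "u \<in> pverts G" "z \<in> pverts G" for u z
    using that reach symmetric_reachable' reachable_trans by meson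
  then have "strongly_connected (with_proj G)"
    using assms(2) by (auto simp: strongly_connected_def)
  then show ?thesis
    unfolding connected_def strongly_connected_def
    by (auto intro: reachable_mk_symmetricI)
qed

text \<open>An isolated vertex, or two adjacent leaves, would form a whole component. By
  connectedness this would be the whole graph, and the skeleton would be empty.\<close>

lemma pendants_skeleton:
  assumes G: "pair_graph G" "connected_graph G" "pverts (skeleton G) \<noteq> {}"
  shows "pendants G (pverts (skeleton G))"
proof -
  let ?S = "pverts (skeleton G)"
  have S: "?S = {x \<in> pverts G. degree G x \<noteq> 0 \<and> degree G x \<noteq> 1}" by (simp add: skeleton_def)
  obtain r where r: "r \<in> ?S" using G(3) by blast
  have "\<exists>s\<in>?S. \<forall>z. (x, z) \<in> parcs G \<longleftrightarrow> z = s" if x: "x \<in> pverts G" "x \<notin> ?S" for x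
  proof -
    have "degree G x \<noteq> 0"
    proof
      assume "degree G x = 0"
      then have "(x, z) \<notin> parcs G" for z
        using finite_neighbours[OF G(1), of x] by (auto simp: degree_eq_card)
      then have "pverts G \<subseteq> {x}" using connected_graph_closed[OF G(1,2), of x "{x}"] x(1) by blast
      with r x show False unfolding S by blast
    qed
    then have "degree G x = 1" using x S by auto
    then obtain s where s: "\<And>z. (x, z) \<in> parcs G \<longleftrightarrow> z = s" using degree_eq_1_iff by metis
    have sx: "(s, x) \<in> parcs G" "s \<in> pverts G" using s G(1) unfolding pair_graph_iff by blast+
    have "s \<in> ?S"
    proof (rule ccontr)
      assume "s \<notin> ?S"
      moreover have "degree G s \<noteq> 0"
        using sx finite_neighbours[OF G(1), of s] by (auto simp: degree_eq_card)
      ultimately have "degree G s = 1" using sx S by auto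
      then have "(s, z) \<in> parcs G \<longleftrightarrow> z = x" for z using degree_eq_1_iff sx by metis
      then have "pverts G \<subseteq> {x, s}"
        using connected_graph_closed[OF G(1,2), of x "{x, s}"] x(1) s by blast
      with r \<open>s \<notin> ?S\<close> x(2) show False unfolding S by blast
    qed
    with s show ?thesis by blast
  qed
  then show ?thesis unfolding pendants_def using S by auto
qed

lemma skeleton_eq_induced: "skeleton G = induced G (pverts (skeleton G))"
  by (simp add: skeleton_def)

section \<open>Cycle labellings, their rotations and reflections\<close>

lemma cycle_labelling_arc_iff:
  assumes "cycle_labelling G c y" "i < c" "j < c"
  shows "(y i, y j) \<in> parcs G \<longleftrightarrow> j = (i + 1) mod c \<or> i = (j + 1) mod c"
proof -
  have "inj_on y {..<c}" using assms(1) by (auto simp: cycle_labelling_def bij_betw_def)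
  then have "y i = y i' \<longleftrightarrow> i = i'" if "i < c" "i' < c" for i i'
    using that by (auto dest: inj_onD)
  with assms show ?thesis by (auto simp: cycle_labelling_def)
qed

text \<open>Common frame for rotations and reflections: both permute the indices and preserve cyclic
  adjacency.\<close>

lemma cycle_labelling_reindex:
  assumes y: "cycle_labelling G c y" and r: "bij_betw r {..<c} {..<c}"
    and adj: "\<And>s t. s < c \<Longrightarrow> t < c \<Longrightarrow>
      (r t = (r s + 1) mod c \<or> r s = (r t + 1) mod c) \<longleftrightarrow> (t = (s + 1) mod c \<or> s = (t + 1) mod c)"
  shows "cycle_labelling G c (\<lambda>i. y (r i))"
proof -
  have c: "3 \<le> c" and b: "bij_betw y {..<c} (pverts G)" using y by (auto simp: cycle_labelling_def)
  have b': "bij_betw (y \<circ> r) {..<c} (pverts G)" using r b by (rule bij_betw_trans)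
  have "parcs G = {(y i, y l) | i l. i < c \<and> l < c \<and> (l = (i + 1) mod c \<or> i = (l + 1) mod c)}"
    using y by (simp add: cycle_labelling_def)
  also have "\<dots> = {(y (r s), y (r t)) | s t. s < c \<and> t < c \<and> (t = (s + 1) mod c \<or> s = (t + 1) mod c)}"
    (is "?L = ?R")
  proof
    show "?L \<subseteq> ?R"
    proof
      fix x assume "x \<in> ?L"
      then obtain i l where il: "x = (y i, y l)" "i < c" "l < c" "l = (i + 1) mod c \<or> i = (l + 1) mod c"
        by blast
      have "i \<in> r ` {..<c}" "l \<in> r ` {..<c}" using il(2,3) bij_betw_imp_surj_on[OF r] by simp_all
      then obtain s t where st: "s < c" "t < c" "i = r s" "l = r t" by blast
      have "t = (s + 1) mod c \<or> s = (t + 1) mod c"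
        using il(4) adj[OF st(1,2)] unfolding st(3,4) by blast
      with il(1) st show "x \<in> ?R" by blast
    qed
    show "?R \<subseteq> ?L"
    proof
      fix x assume "x \<in> ?R"
      then obtain s t where st: "x = (y (r s), y (r t))" "s < c" "t < c"
        "t = (s + 1) mod c \<or> s = (t + 1) mod c" by blast
      then have "r t = (r s + 1) mod c \<or> r s = (r t + 1) mod c" using adj[OF st(2,3)] by blast
      moreover have "r s < c" "r t < c" using bij_betwE[OF r] st(2,3) by auto
      ultimately show "x \<in> ?L" using st(1) by blast
    qed
  qed
  finally show ?thesis using c b' by (simp add: cycle_labelling_def comp_def)
qed

lemma cycle_labelling_rotate:
  assumes y: "cycle_labelling G c y" and j: "j < c"
  shows "cycle_labelling G c (\<lambda>i. y ((i + j) mod c))"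
proof -
  have c: "3 \<le> c" using y by (simp add: cycle_labelling_def)
  let ?r = "\<lambda>i. (i + j) mod c"
  \<comment> \<open>Here \<open>c\<close> divides \<open>t - s\<close>, which is less than
    \<open>c\<close>. The order of \<open>s\<close> and \<open>t\<close> is fixed because
    subtraction on \<open>nat\<close> truncates.\<close>
  have le: "s = t" if "s \<le> t" "t < c" "(s + j) mod c = (t + j) mod c" for s t
  proof -
    have "c dvd (t + j) - (s + j)" using that mod_eq_dvd_iff_nat[of "s + j" "t + j" c] by simp
    then have "c dvd t - s" by simp
    then show ?thesis using that by (auto dest: dvd_imp_le)
  qed
  have inj: "inj_on ?r {..<c}"
  proof (rule inj_onI)
    fix s t assume "s \<in> {..<c}" "t \<in> {..<c}" "(s + j) mod c = (t + j) mod c"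
    then show "s = t" using le[of s t] le[of t s] by (cases "s \<le> t") auto
  qed
  moreover have "?r ` {..<c} \<subseteq> {..<c}" using c by auto
  ultimately have r: "bij_betw ?r {..<c} {..<c}"
    by (simp add: bij_betw_def endo_inj_surj)
  have suc: "?r t = (?r s + 1) mod c \<longleftrightarrow> t = (s + 1) mod c" if "s < c" "t < c" for s t
  proof -
    have "(?r s + 1) mod c = (s + j + 1) mod c" by (rule mod_add_left_eq)
    also have "s + j + 1 = s + 1 + j" by simp
    also have "(s + 1 + j) mod c = ?r ((s + 1) mod c)" by (rule mod_add_left_eq[symmetric])
    finally have "(?r s + 1) mod c = ?r ((s + 1) mod c)" .
    then show ?thesis using inj_on_eq_iff[OF inj, of t "(s + 1) mod c"] that c by simp
  qed
  show ?thesis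
    using cycle_labelling_reindex[OF y r] suc by simp
qed

text \<open>Here \<open>s'\<close> and \<open>t'\<close> are the negatives of \<open>s\<close> and
  \<open>t\<close> modulo \<open>Suc d\<close>, and \<open>d\<close> is the last residue. Negation
  reverses the cyclic successor relation; written without \<open>mod\<close>, this is a finite case
  check.\<close>

lemma neg_succ_iff:
  fixes s t s' t' d :: nat
  assumes s: "s' = 0 \<and> s = 0 \<or> s' + s = Suc d" "s \<le> d" "s' \<le> d"
    and t: "t' = 0 \<and> t = 0 \<or> t' + t = Suc d" "t \<le> d" "t' \<le> d" and d: "2 \<le> d"
  shows "t' = (if s' = d then 0 else Suc s') \<longleftrightarrow> s = (if t = d then 0 else Suc t)"
  using assms by (cases "s = 0"; cases "t = 0"; auto)

lemma cycle_labelling_reflect: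
  assumes y: "cycle_labelling G c y"
  shows "cycle_labelling G c (\<lambda>i. y ((c - i) mod c))"
proof (rule cycle_labelling_reindex[OF y])
  have c: "3 \<le> c" using y by (simp add: cycle_labelling_def)
  have r: "(c - s) mod c = (if s = 0 then 0 else c - s)" if "s < c" for s using that by simp
  have suc: "(s + 1) mod c = (if s = c - 1 then 0 else Suc s)" if "s < c" for s
    using that by (auto intro: mod_less)
  show "bij_betw (\<lambda>i. (c - i) mod c) {..<c} {..<c}"
    by (rule bij_betw_byWitness[where f' = "\<lambda>i. (c - i) mod c"]) (use c r in auto)
  fix s t assume st: "s < c" "t < c"
  define s' t' where "s' = (c - s) mod c" and "t' = (c - t) mod c"
  then have lt: "s' < c" "t' < c" and s': "s' = 0 \<and> s = 0 \<or> s' + s = c" and t': "t' = 0 \<and> t = 0 \<or> t' + t = c"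
    using c r[OF st(1)] r[OF st(2)] st by auto
  obtain d where d: "c = Suc d" using c by (cases c) auto
  have "t' = (if s' = d then 0 else Suc s') \<longleftrightarrow> s = (if t = d then 0 else Suc t)"
    using neg_succ_iff[of s' s d t' t] s' t' st lt c d by simp
  moreover have "s' = (if t' = d then 0 else Suc t') \<longleftrightarrow> t = (if s = d then 0 else Suc s)"
    using neg_succ_iff[of t' t d s' s] s' t' st lt c d by simp
  ultimately have "(t' = (if s' = c - 1 then 0 else Suc s') \<or> s' = (if t' = c - 1 then 0 else Suc t')) \<longleftrightarrow>
      (t = (if s = c - 1 then 0 else Suc s) \<or> s = (if t = c - 1 then 0 else Suc t))"
    unfolding d diff_Suc_1 by blast
  then show "((c - t) mod c = ((c - s) mod c + 1) mod c \<or> (c - s) mod c = ((c - t) mod c + 1) mod c) \<longleftrightarrow>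
      (t = (s + 1) mod c \<or> s = (t + 1) mod c)"
    by (simp only: suc[OF lt(1)] suc[OF lt(2)] suc[OF st(1)] suc[OF st(2)] s'_def[symmetric] t'_def[symmetric])
qed

text \<open>A rotation brings \<open>x0\<close> to index 0. If the two neighbours of
  \<open>v\<close> then come in the wrong order, the reflection that fixes index 0 exchanges them.
  Later \<open>d\<close> is the degree in the supercard.\<close>

lemma cycle_labelling_mark:
  fixes d :: "'a \<Rightarrow> nat"
  assumes y: "cycle_labelling G c y" and "x0 \<in> pverts G" "v \<in> pverts G"
  shows "\<exists>x \<nu>. cycle_labelling G c x \<and> x 0 = x0 \<and> \<nu> < c \<and> v = x \<nu> \<and>
    d (x ((\<nu> + c - 1) mod c)) \<ge> d (x ((\<nu> + 1) mod c))"
proof -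
  have c: "3 \<le> c" and b: "y ` {..<c} = pverts G" using y by (auto simp: cycle_labelling_def bij_betw_def)
  from assms(2) obtain j where j: "j < c" "x0 = y j" unfolding b[symmetric] by auto
  define z where "z i = y ((i + j) mod c)" for i
  have z: "cycle_labelling G c z" unfolding z_def using y j(1) by (rule cycle_labelling_rotate)
  have z0: "z 0 = x0" using j by (simp add: z_def)
  have "z ` {..<c} = pverts G" using z by (auto simp: cycle_labelling_def bij_betw_def)
  with assms(3) obtain \<nu> where n: "\<nu> < c" "v = z \<nu>" by auto
  show ?thesis
  proof (cases "d (z ((\<nu> + c - 1) mod c)) \<ge> d (z ((\<nu> + 1) mod c))")
    case True
    with z z0 n show ?thesis by blast
  next
    case False
    define x where "x i = z ((c - i) mod c)" for i
    \<comment> \<open>The index of \<open>v\<close> in the reflected labelling.\<close>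
    define \<mu> where "\<mu> = (c - \<nu>) mod c"
    have x: "cycle_labelling G c x" unfolding x_def using z by (rule cycle_labelling_reflect)
    have pr: "(\<kappa> + c - 1) mod c = (if \<kappa> = 0 then c - 1 else \<kappa> - 1)" if "\<kappa> < c" for \<kappa>
    proof (cases "\<kappa> = 0")
      case False
      then have "\<kappa> + c - 1 = \<kappa> - 1 + c" by simp
      then have "(\<kappa> + c - 1) mod c = (\<kappa> - 1) mod c" by (simp only: mod_add_self2)
      then show ?thesis using that False by simp
    qed (use c in simp)
    have su: "(\<kappa> + 1) mod c = (if \<kappa> = c - 1 then 0 else Suc \<kappa>)" if "\<kappa> < c" for \<kappa>
      using that by (auto intro: mod_less)
    have re: "(c - \<kappa>) mod c = (if \<kappa> = 0 then 0 else c - \<kappa>)" if "\<kappa> < c" for \<kappa> using that by simp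
    have m: "\<mu> < c" using c by (simp add: \<mu>_def)
    have "x \<mu> = v" using n c by (simp add: x_def \<mu>_def re)
    moreover have "x ((\<mu> + 1) mod c) = z ((\<nu> + c - 1) mod c)"
    proof -
      have "(c - (\<mu> + 1) mod c) mod c = (\<nu> + c - 1) mod c"
        unfolding su[OF m] pr[OF n(1)] unfolding \<mu>_def re[OF n(1)] using c n(1) by auto
      then show ?thesis by (simp add: x_def)
    qed
    moreover have "x ((\<mu> + c - 1) mod c) = z ((\<nu> + 1) mod c)"
    proof -
      have "(c - (\<mu> + c - 1) mod c) mod c = (\<nu> + 1) mod c"
        unfolding su[OF n(1)] pr[OF m] unfolding \<mu>_def re[OF n(1)] using c n(1) by auto
      then show ?thesis by (simp add: x_def)
    qed
    moreover have "x 0 = x0" using c z0 by (simp add: x_def)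
    ultimately show ?thesis using x m False by (intro exI[of _ x] exI[of _ \<mu>]) simp
  qed
qed

lemma cycle_labelling_induced_arc_iff:
  assumes "cycle_labelling (induced G S) c y" "i < c" "j < c"
  shows "(y i, y j) \<in> parcs G \<longleftrightarrow> j = (i + 1) mod c \<or> i = (j + 1) mod c"
proof -
  have "y i \<in> S" "y j \<in> S" using assms by (auto simp: cycle_labelling_def bij_betw_def)
  with cycle_labelling_arc_iff[OF assms] show ?thesis by simp
qed

lemma cycle_labelling_inducedD:
  assumes "cycle_labelling (induced G S) c y"
  shows "3 \<le> c" "bij_betw y {..<c} S"
  using assms by (auto simp: cycle_labelling_def)

lemma cycle_labelling_two_neighbours:
  assumes y: "cycle_labelling (induced G S) c y" and x: "x \<in> S"
  obtains s t where "s \<in> S" "t \<in> S" "s \<noteq> t" "(x, s) \<in> parcs G" "(x, t) \<in> parcs G"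
proof -
  note c = cycle_labelling_inducedD(1)[OF y] and b = cycle_labelling_inducedD(2)[OF y]
  obtain i where i: "i < c" "x = y i" using x b by (auto simp: bij_betw_def)
  \<comment> \<open>Cyclic successor and predecessor of \<open>i\<close>; they differ because
    \<open>3 \<le> c\<close>.\<close>
  let ?s = "(i + 1) mod c" and ?t = "if i = 0 then c - 1 else i - 1"
  have t: "?t < c" "i = (?t + 1) mod c" using i c by auto
  have st: "?s \<noteq> ?t" using i c by (auto simp: mod_if)
  have s: "?s < c" using c by simp
  have "y ?s \<noteq> y ?t" using s t(1) st inj_onD[OF bij_betw_imp_inj_on[OF b], of ?s ?t] by blast
  moreover have "y ?s \<in> S" "y ?t \<in> S" using b s t(1) by (auto simp: bij_betw_def)
  moreover have "(x, y ?s) \<in> parcs G" "(x, y ?t) \<in> parcs G"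
    using cycle_labelling_induced_arc_iff[OF y i(1) s] cycle_labelling_induced_arc_iff[OF y i(1) t(1)]
      t(2) i(2) by auto
  ultimately show thesis using that by blast
qed

section \<open>Sunshine graphs and caterpillars as a cycle or a path with leaves\<close>

lemma sunshineD:
  assumes "sunshine G"
  shows "pair_graph G" "\<exists>S c y. pendants G S \<and> cycle_labelling (induced G S) c y"
proof -
  show G: "pair_graph G" using assms by (simp add: sunshine_def)
  obtain c y where y: "cycle_labelling (skeleton G) c y"
    using assms by (auto simp: sunshine_def is_cycle_def)
  then have "pverts (skeleton G) \<noteq> {}"
    by (auto simp: cycle_labelling_def bij_betw_def lessThan_empty_iff)
  then have "pendants G (pverts (skeleton G))"
    using pendants_skeleton[OF G] assms by (simp add: sunshine_def)
  with y show "\<exists>S c y. pendants G S \<and> cycle_labelling (induced G S) c y"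
    using skeleton_eq_induced by metis
qed

text \<open>Vertices of the cycle have degree at least 2 and pendant vertices have degree 1, so the
  degrees recover \<open>S\<close>.\<close>

lemma skeleton_eq_inducedI:
  assumes "pair_graph G" "pendants G S" "cycle_labelling (induced G S) c y"
  shows "skeleton G = induced G S"
proof -
  have "x \<in> S \<longleftrightarrow> x \<in> pverts G \<and> degree G x \<noteq> 0 \<and> degree G x \<noteq> 1" for x
  proof (cases "x \<in> S")
    case True
    then have "2 \<le> degree G x"
      using cycle_labelling_two_neighbours[OF assms(3) True] two_le_degreeI[OF assms(1)] by metis
    moreover have "x \<in> pverts G" using True assms(2) by (auto simp: pendants_def)
    ultimately show ?thesis using True by simp
  next
    case False
    then show ?thesis
      using degree_eq_1_iff[of G x] by (metis assms(2) pendants_leaf)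
  qed
  then have "S = {x \<in> pverts G. degree G x \<noteq> 0 \<and> degree G x \<noteq> 1}" by blast
  then show ?thesis unfolding skeleton_def by simp
qed

lemma sunshineI:
  assumes G: "pair_graph G" "pendants G S" and y: "cycle_labelling (induced G S) c y"
  shows "sunshine G"
proof -
  note c = cycle_labelling_inducedD(1)[OF y] and b = cycle_labelling_inducedD(2)[OF y]
  have "connected_graph G"
  proof (rule connected_graphI[OF G(1)])
    show "y 0 \<in> pverts G" using b c G(2) by (auto simp: bij_betw_def pendants_def)
    fix A assume A: "y 0 \<in> A" "\<And>y z. y \<in> A \<Longrightarrow> (y, z) \<in> parcs G \<Longrightarrow> z \<in> A"
    \<comment> \<open>A closed set containing \<open>y 0\<close> picks up the cycle vertices one
      after the other, and afterwards each leaf through its neighbour.\<close>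
    have "i < c \<longrightarrow> y i \<in> A" for i
    proof (induction i)
      case (Suc i)
      then show ?case
        using cycle_labelling_induced_arc_iff[OF y, of i "Suc i"] A(2)[of "y i" "y (Suc i)"] by auto
    qed (use A in simp)
    then have S: "S \<subseteq> A" using b by (auto simp: bij_betw_def)
    show "pverts G \<subseteq> A"
    proof
      fix x assume x: "x \<in> pverts G"
      show "x \<in> A"
      proof (cases "x \<in> S")
        case False
        then obtain s where "s \<in> S" "(x, s) \<in> parcs G" using x G(2) pendants_leaf by metis
        then show ?thesis using A(2) S G(1) by (metis pair_graph_iff subsetD)
      qed (use S in blast)
    qed
  qed
  then show ?thesis
    using G(1) y skeleton_eq_inducedI[OF G y] by (auto simp: sunshine_def is_cycle_def)
qed

text \<open>A longest path of a caterpillar: its ends, at indices 0 and \<open>Suc k\<close>, are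
  leaves, and the indices from 1 to \<open>k\<close> give the skeleton. The end leaves belong to it
  because the cycle of a supercard may run through them.\<close>

definition spine :: "'a ugraph \<Rightarrow> nat \<Rightarrow> (nat \<Rightarrow> 'a) \<Rightarrow> bool" where
  "spine T k p \<longleftrightarrow>
     1 \<le> k \<and> inj_on p {..Suc k} \<and> p ` {..Suc k} \<subseteq> pverts T \<and>
     (\<forall>i \<le> Suc k. \<forall>j \<le> Suc k. (p i, p j) \<in> parcs T \<longleftrightarrow> j = Suc i \<or> i = Suc j) \<and>
     pendants T (p ` {1..k})"

text \<open>An end of the skeleton path has degree at least 2 but at most one neighbour on the
  skeleton, so a leaf can be appended there. If the skeleton is a single vertex, two different
  leaves of it serve.\<close>

lemma caterpillar_spine:
  assumes "caterpillar T"
  shows "\<exists>k p. spine T k p"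
proof -
  have G: "pair_graph T" "connected_graph T" using assms by (auto simp: caterpillar_def)
  obtain k z where z: "path_labelling (skeleton T) k z"
    using assms by (auto simp: caterpillar_def is_path_def)
  let ?S = "pverts (skeleton T)"
  have k: "1 \<le> k" and b: "bij_betw z {..<k} ?S" using z by (auto simp: path_labelling_def)
  then have "?S \<noteq> {}" by (auto simp: bij_betw_def lessThan_empty_iff)
  then have pend: "pendants T ?S" using pendants_skeleton G by blast
  have zin: "i < k \<Longrightarrow> z i \<in> ?S" for i using b by (auto simp: bij_betw_def)
  have zinj: "i < k \<Longrightarrow> j < k \<Longrightarrow> z i = z j \<longleftrightarrow> i = j" for i j
    using b by (auto simp: bij_betw_def dest: inj_onD)
  have zarc: "(z i, z j) \<in> parcs T \<longleftrightarrow> j = Suc i \<or> i = Suc j" if "i < k" "j < k" for i j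
  proof -
    have "(z i, z j) \<in> parcs T \<longleftrightarrow> (z i, z j) \<in> parcs (skeleton T)"
      using zin that by (subst skeleton_eq_induced) simp
    also have "\<dots> \<longleftrightarrow> j = Suc i \<or> i = Suc j"
      using z that zinj by (auto simp: path_labelling_def)
    finally show ?thesis .
  qed
  have deg: "2 \<le> degree T s" if "s \<in> ?S" for s using that by (auto simp: skeleton_def)
  have "\<exists>l l'. l \<noteq> l' \<and> l \<notin> ?S \<and> l' \<notin> ?S \<and> (z 0, l) \<in> parcs T \<and> (z (k - 1), l') \<in> parcs T"
  proof (cases "k = 1")
    case True
    then have "?S = {z 0}" using b by (auto simp: bij_betw_def)
    moreover from True k have "z 0 \<in> ?S" using zin by simp
    then obtain l l' where l: "(z 0, l) \<in> parcs T" "(z 0, l') \<in> parcs T" "l \<noteq> l'"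
      using two_le_degreeE deg by metis
    moreover have "l \<noteq> z 0" "l' \<noteq> z 0" using l G(1) unfolding pair_graph_iff by blast+
    ultimately show ?thesis using True by auto
  next
    case False
    with k have k2: "2 \<le> k" by simp
    have leaf: "\<exists>l. l \<notin> ?S \<and> (z i, l) \<in> parcs T" if i: "i = 0 \<or> i = k - 1" for i
    proof -
      have ik: "i < k" using i k by auto
      obtain s t where st: "(z i, s) \<in> parcs T" "(z i, t) \<in> parcs T" "s \<noteq> t"
        using two_le_degreeE deg zin[OF ik] by metis
      have "\<not> (s \<in> ?S \<and> t \<in> ?S)"
      proof
        assume "s \<in> ?S \<and> t \<in> ?S"
        then obtain j j' where "s = z j" "j < k" "t = z j'" "j' < k"
          using bij_betw_imp_surj_on[OF b] by (metis imageE lessThan_iff)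
        with st i ik zarc show False by auto
      qed
      with st show ?thesis by blast
    qed
    obtain l l' where l: "l \<notin> ?S" "(z 0, l) \<in> parcs T" "l' \<notin> ?S" "(z (k - 1), l') \<in> parcs T"
      using leaf by blast
    have "l \<noteq> l'"
    proof
      assume "l = l'"
      moreover have "(l, z 0) \<in> parcs T" "(l', z (k - 1)) \<in> parcs T" "l \<in> pverts T"
        using l G(1) by (auto simp: pair_graph_iff)
      ultimately have "z 0 = z (k - 1)" using pendants_leaf[OF pend, of l] l(1) by metis
      then show False using zinj[of 0 "k - 1"] k2 by simp
    qed
    with l show ?thesis by blast
  qed
  then obtain l l' where l: "l \<noteq> l'" "l \<notin> ?S" "l' \<notin> ?S" "(z 0, l) \<in> parcs T" "(z (k - 1), l') \<in> parcs T"
    by blast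
  have lT: "l \<in> pverts T" "l' \<in> pverts T" "(l, z 0) \<in> parcs T" "(l', z (k - 1)) \<in> parcs T"
    using l G(1) by (auto simp: pair_graph_iff)
  have l_iff: "(l, s) \<in> parcs T \<longleftrightarrow> s = z 0" "(s, l) \<in> parcs T \<longleftrightarrow> s = z 0"
     "(l', s) \<in> parcs T \<longleftrightarrow> s = z (k - 1)" "(s, l') \<in> parcs T \<longleftrightarrow> s = z (k - 1)" for s
  proof -
    have sym: "(s, t) \<in> parcs T \<longleftrightarrow> (t, s) \<in> parcs T" for s t using G(1) unfolding pair_graph_iff by blast
    show a: "(l, s) \<in> parcs T \<longleftrightarrow> s = z 0" using pendants_leaf[OF pend lT(1) l(2)] lT(3) by metis
    show b: "(l', s) \<in> parcs T \<longleftrightarrow> s = z (k - 1)" using pendants_leaf[OF pend lT(2) l(3)] lT(4) by metis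
    show "(s, l) \<in> parcs T \<longleftrightarrow> s = z 0" "(s, l') \<in> parcs T \<longleftrightarrow> s = z (k - 1)" using a b sym by blast+
  qed
  \<comment> \<open>The skeleton labelling \<open>z\<close> starts at 0; the shift by one makes room
    for the leaf \<open>l\<close>.\<close>
  define p where "p i = (if i = 0 then l else if i \<le> k then z (i - 1) else l')" for i
  have S: "p ` {1..k} = ?S"
  proof -
    have "p ` {1..k} = z ` {..<k}"
    proof -
      have "(\<lambda>i. i - 1) ` {1..k} = {..<k}"
        by (auto simp: image_iff intro!: bexI[of _ "Suc _"])
      then have "z ` {..<k} = (\<lambda>i. z (i - 1)) ` {1..k}" using image_image[of z "\<lambda>i. i - 1" "{1..k}"] by simp
      also have "\<dots> = p ` {1..k}" by (intro image_cong) (auto simp: p_def)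
      finally show ?thesis by simp
    qed
    with b show ?thesis by (simp add: bij_betw_def)
  qed
  have zl: "z i \<noteq> l" "z i \<noteq> l'" "l \<noteq> z i" "l' \<noteq> z i" if "i < k" for i
    using zin[OF that] l by auto
  have "inj_on p {..Suc k}"
  proof (rule inj_onI)
    fix i j assume "i \<in> {..Suc k}" "j \<in> {..Suc k}" and eq: "p i = p j"
    then have ij: "i \<le> Suc k" "j \<le> Suc k" by auto
    have "i - 1 < k \<or> i = Suc k" "j - 1 < k \<or> j = Suc k" using ij k by auto
    then show "i = j"
      using eq ij l(1) zl zinj[of "i - 1" "j - 1"]
      by (auto simp: p_def split: if_splits)
  qed
  moreover have "?S \<subseteq> pverts T" using pend by (simp add: pendants_def)
  then have "p ` {..Suc k} \<subseteq> pverts T"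
    using lT zin by (auto simp: p_def)
  moreover have "(p i, p j) \<in> parcs T \<longleftrightarrow> j = Suc i \<or> i = Suc j" if ij: "i \<le> Suc k" "j \<le> Suc k" for i j
  proof -
    consider "i = 0" | "i = Suc k" | "0 < i" "i \<le> k" using ij by linarith
    then show ?thesis
    proof cases
      case 1
      then have "(p i, p j) \<in> parcs T \<longleftrightarrow> p j = z 0" by (simp add: p_def l_iff)
      also have "\<dots> \<longleftrightarrow> j = 1"
        using zl[of 0] zinj[of "j - 1" 0] k ij by (auto simp: p_def)
      finally show ?thesis using 1 by auto
    next
      case 2
      then have "(p i, p j) \<in> parcs T \<longleftrightarrow> p j = z (k - 1)" by (simp add: p_def l_iff)
      also have "\<dots> \<longleftrightarrow> j = k"
        using zl[of "k - 1"] zinj[of "j - 1" "k - 1"] k ij by (auto simp: p_def)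
      finally show ?thesis using 2 ij by auto
    next
      case 3
      then have i: "p i = z (i - 1)" "i - 1 < k" by (auto simp: p_def)
      consider "j = 0" | "j = Suc k" | "0 < j" "j \<le> k" using ij by linarith
      then show ?thesis
      proof cases
        case 1
        then show ?thesis using i 3 k zinj[of "i - 1" 0] by (auto simp: p_def l_iff)
      next
        case 2
        then show ?thesis using i 3 k zinj[of "i - 1" "k - 1"] by (auto simp: p_def l_iff)
      next
        case j: 3
        then have "p j = z (j - 1)" "j - 1 < k" by (auto simp: p_def)
        then show ?thesis using i zarc[of "i - 1" "j - 1"] j 3 by auto
      qed
    qed
  qed
  ultimately have "spine T k p" unfolding spine_def S using k pend by blast
  then show ?thesis by blast
qed

lemma pendants_iso:
  assumes "pendants G S" "is_isomorphism g G H" "pair_wf_digraph G" "pair_wf_digraph H"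
  shows "pendants H (g ` S)"
proof -
  interpret G: pair_wf_digraph G by fact
  interpret H: pair_wf_digraph H by fact
  have img: "g ` pverts G = pverts H"
    and arc: "\<And>x y. x \<in> pverts G \<Longrightarrow> y \<in> pverts G \<Longrightarrow> (g x, g y) \<in> parcs H \<longleftrightarrow> (x, y) \<in> parcs G"
    using assms(2) by (auto simp: is_isomorphism_def bij_betw_def)
  have S: "S \<subseteq> pverts G" using assms(1) by (simp add: pendants_def)
  have "\<exists>s\<in>g ` S. \<forall>z. (x, z) \<in> parcs H \<longleftrightarrow> z = s" if x: "x \<in> pverts H" "x \<notin> g ` S" for x
  proof -
    obtain x' where x': "x' \<in> pverts G" "x = g x'" "x' \<notin> S" using x img by blast
    obtain s where s: "s \<in> S" "\<And>z. (x', z) \<in> parcs G \<longleftrightarrow> z = s"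
      using pendants_leaf[OF assms(1) x'(1,3)] by metis
    have "(x, z) \<in> parcs H \<longleftrightarrow> z = g s" for z
    proof
      assume xz: "(x, z) \<in> parcs H"
      then obtain z' where "z' \<in> pverts G" "z = g z'" using img H.in_arcsD2 by blast
      with xz x' arc s(2) show "z = g s" by auto
    next
      assume "z = g s"
      with x' arc s S show "(x, z) \<in> parcs H" by auto
    qed
    with s(1) show ?thesis by blast
  qed
  moreover have "g ` S \<subseteq> pverts H" using S img by blast
  ultimately show ?thesis by (simp add: pendants_def)
qed

lemma spine_iso:
  assumes "spine T k p" "is_isomorphism g T H" "pair_wf_digraph T" "pair_wf_digraph H"
  shows "spine H k (g \<circ> p)"
proof -
  have g: "inj_on g (pverts T)" "g ` pverts T = pverts H"
    and arc: "\<And>x y. x \<in> pverts T \<Longrightarrow> y \<in> pverts T \<Longrightarrow> (g x, g y) \<in> parcs H \<longleftrightarrow> (x, y) \<in> parcs T"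
    using assms(2) by (auto simp: is_isomorphism_def bij_betw_def)
  have p: "p ` {..Suc k} \<subseteq> pverts T" "inj_on p {..Suc k}" using assms(1) by (auto simp: spine_def)
  have "inj_on (g \<circ> p) {..Suc k}" using p g(1) by (metis comp_inj_on inj_on_subset)
  moreover have "pendants H ((g \<circ> p) ` {1..k})"
    using assms pendants_iso by (metis image_comp spine_def)
  moreover have "i \<le> Suc k \<Longrightarrow> p i \<in> pverts T" for i using p(1) by auto
  ultimately show ?thesis
    using assms(1) g(2) arc unfolding spine_def by auto
qed

lemma spineD:
  assumes "spine T k p"
  shows "1 \<le> k" "inj_on p {..Suc k}" "\<And>i. i \<le> Suc k \<Longrightarrow> p i \<in> pverts T" "pendants T (p ` {1..k})"
    and "\<And>i j. i \<le> Suc k \<Longrightarrow> j \<le> Suc k \<Longrightarrow> (p i, p j) \<in> parcs T \<longleftrightarrow> j = Suc i \<or> i = Suc j"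
    and "\<And>i j. i \<le> Suc k \<Longrightarrow> j \<le> Suc k \<Longrightarrow> p i = p j \<longleftrightarrow> i = j"
  using assms by (auto simp: spine_def dest: inj_onD)

lemma spine_leaf:
  assumes "spine T k p" "u \<in> pverts T" "u \<notin> p ` {1..k}" "(u, s) \<in> parcs T"
  shows "(u, z) \<in> parcs T \<longleftrightarrow> z = s"
  using pendants_leaf[OF spineD(4)[OF assms(1)] assms(2,3)] assms(4) by metis

lemma spine_end_notin:
  assumes "spine T k p"
  shows "p 0 \<notin> p ` {1..k}" "p (Suc k) \<notin> p ` {1..k}"
proof -
  have "p i \<noteq> p 0 \<and> p i \<noteq> p (Suc k)" if "i \<in> {1..k}" for i
    using that spineD(6)[OF assms, of i 0] spineD(6)[OF assms, of i "Suc k"] by auto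
  then show "p 0 \<notin> p ` {1..k}" "p (Suc k) \<notin> p ` {1..k}" by (metis imageE)+
qed

lemma spine_has_neighbour:
  assumes "spine T k p" "x \<in> pverts T"
  shows "\<exists>z. (x, z) \<in> parcs T"
proof (cases "x \<in> p ` {1..k}")
  case True
  then obtain i where "i \<in> {1..k}" "x = p i" by blast
  then have "(x, p (Suc i)) \<in> parcs T" using spineD(5)[OF assms(1), of i "Suc i"] by simp
  then show ?thesis by blast
next
  case False
  then show ?thesis using pendants_leaf[OF spineD(4)[OF assms(1)] assms(2)] by metis
qed

text \<open>A leaf does not have two neighbours, so \<open>C\<close> lies on the inner path. The
  vertex of \<open>C\<close> with the largest index there has at most one neighbour in
  \<open>C\<close>, the one before it.\<close>

lemma spine_acyclic:
  assumes T: "spine T k p" and C: "C \<subseteq> pverts T" "C \<noteq> {}"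
    and nbr: "\<And>x. x \<in> C \<Longrightarrow> \<exists>s\<in>C. \<exists>t\<in>C. s \<noteq> t \<and> (x, s) \<in> parcs T \<and> (x, t) \<in> parcs T"
  shows False
proof -
  have sub: "C \<subseteq> p ` {1..k}"
  proof
    fix x assume x: "x \<in> C"
    with nbr obtain s t where "s \<noteq> t" "(x, s) \<in> parcs T" "(x, t) \<in> parcs T" by blast
    then show "x \<in> p ` {1..k}" using spine_leaf[OF T] x C(1) by blast
  qed
  let ?J = "{j \<in> {1..k}. p j \<in> C}"
  have J: "finite ?J" "?J \<noteq> {}" using sub C(2) by auto
  let ?j = "Max ?J"
  have j: "?j \<in> ?J" using J by (rule Max_in)
  then obtain s t where st: "s \<in> C" "t \<in> C" "s \<noteq> t" "(p ?j, s) \<in> parcs T" "(p ?j, t) \<in> parcs T"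
    using nbr by blast
  have "z = p (?j - 1)" if z: "z \<in> C" "(p ?j, z) \<in> parcs T" for z
  proof -
    obtain i where i: "i \<in> {1..k}" "z = p i" using z(1) sub by blast
    then have "i \<le> ?j" using z(1) J(1) by (intro Max_ge) auto
    moreover have "i = Suc ?j \<or> ?j = Suc i"
      using spineD(5)[OF T, of ?j i] z(2) i j by auto
    ultimately show ?thesis using i(2) by auto
  qed
  with st show False by blast
qed

text \<open>Removing \<open>p j\<close> cuts the caterpillar. The set \<open>?L\<close> is the side
  of the smaller indices: those path vertices and the leaves hanging on them. The vertex
  \<open>p j\<close> is excluded explicitly, being adjacent to \<open>p (j - 1)\<close>.\<close>

lemma spine_separation:
  assumes T: "pair_graph T" "spine T k p" and j: "j \<le> k"
  shows "\<exists>L. p ` {..<j} \<subseteq> L \<and> p ` {j<..Suc k} \<inter> L = {} \<and>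
    (\<forall>x\<in>L. \<forall>z. (x, z) \<in> parcs T \<longrightarrow> z \<noteq> p j \<longrightarrow> z \<in> L)"
proof (intro exI conjI ballI allI impI)
  let ?L = "{x \<in> pverts T. x \<noteq> p j \<and> (\<exists>i<j. x = p i \<or> (x, p i) \<in> parcs T)}"
  note arc = spineD(5)[OF T(2)] and eq = spineD(6)[OF T(2)] and pin = spineD(3)[OF T(2)]
  show "p ` {..<j} \<subseteq> ?L" using j pin eq by auto
  show "p ` {j<..Suc k} \<inter> ?L = {}" using j arc eq by auto
  fix x z assume x: "x \<in> ?L" and xz: "(x, z) \<in> parcs T" and z: "z \<noteq> p j"
  have zx: "(z, x) \<in> parcs T" "z \<in> pverts T" using xz T(1) unfolding pair_graph_iff by blast+
  obtain i where i: "i < j" "x = p i \<or> (x, p i) \<in> parcs T" using x by blast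
  show "z \<in> ?L"
  proof (cases "x \<in> p ` {..Suc k}")
    case True
    then obtain i' where i': "i' \<le> Suc k" "x = p i'" by auto
    then have "i' = i \<or> i' = Suc i \<or> i = Suc i'" using i j arc eq by auto
    moreover have "i' \<noteq> j" using i' x by auto
    ultimately have "i' < j" using i by auto
    then show ?thesis using zx z i'(2) by auto
  next
    case False
    then have "x \<notin> p ` {1..k}" "(x, p i) \<in> parcs T" using i j by auto
    then have "z = p i" using spine_leaf[OF T(2)] x xz by blast
    then show ?thesis using zx z i by auto
  qed
qed

text \<open>This is what remains of a sunshine graph when a cycle vertex is deleted. In contrast to
  \<open>pendants\<close>, vertices off the path may be isolated, because the leaves at the deleted
  vertex lose their only neighbour.\<close>

definition dominating_path :: "'a ugraph \<Rightarrow> nat \<Rightarrow> (nat \<Rightarrow> 'a) \<Rightarrow> bool" where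
  "dominating_path G m q \<longleftrightarrow>
     inj_on q {1..m} \<and> q ` {1..m} \<subseteq> pverts G \<and>
     (\<forall>i\<in>{1..m}. \<forall>j\<in>{1..m}. (q i, q j) \<in> parcs G \<longleftrightarrow> j = Suc i \<or> i = Suc j) \<and>
     (\<forall>x\<in>pverts G - q ` {1..m}. \<forall>z. (x, z) \<in> parcs G \<longrightarrow>
        z \<in> q ` {1..m} \<and> (\<forall>z'. (x, z') \<in> parcs G \<longrightarrow> z' = z))"

lemma dominating_pathD:
  assumes "dominating_path G m q"
  shows "inj_on q {1..m}" "\<And>i. 1 \<le> i \<Longrightarrow> i \<le> m \<Longrightarrow> q i \<in> pverts G"
    and "\<And>i j. 1 \<le> i \<Longrightarrow> i \<le> m \<Longrightarrow> 1 \<le> j \<Longrightarrow> j \<le> m \<Longrightarrow>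
      (q i, q j) \<in> parcs G \<longleftrightarrow> j = Suc i \<or> i = Suc j"
    and "\<And>i j. 1 \<le> i \<Longrightarrow> i \<le> m \<Longrightarrow> 1 \<le> j \<Longrightarrow> j \<le> m \<Longrightarrow> q i = q j \<longleftrightarrow> i = j"
    and "\<And>x z. x \<in> pverts G \<Longrightarrow> (x, z) \<in> parcs G \<Longrightarrow> x \<in> q ` {1..m} \<or> z \<in> q ` {1..m}"
    and "\<And>x z z'. x \<in> pverts G \<Longrightarrow> (x, z) \<in> parcs G \<Longrightarrow> (x, z') \<in> parcs G \<Longrightarrow> z \<noteq> z' \<Longrightarrow>
      x \<in> q ` {1..m}"
proof -
  show i: "inj_on q {1..m}" using assms unfolding dominating_path_def by (elim conjE)
  have sub: "q ` {1..m} \<subseteq> pverts G" using assms unfolding dominating_path_def by (elim conjE)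
  have arc: "\<forall>i\<in>{1..m}. \<forall>j\<in>{1..m}. (q i, q j) \<in> parcs G \<longleftrightarrow> j = Suc i \<or> i = Suc j"
    using assms unfolding dominating_path_def by (elim conjE)
  have "\<forall>x\<in>pverts G - q ` {1..m}. \<forall>z. (x, z) \<in> parcs G \<longrightarrow>
      z \<in> q ` {1..m} \<and> (\<forall>z'. (x, z') \<in> parcs G \<longrightarrow> z' = z)"
    using assms unfolding dominating_path_def by (elim conjE)
  then have off: "z \<in> q ` {1..m}" "(x, z') \<in> parcs G \<Longrightarrow> z' = z"
    if "x \<in> pverts G" "x \<notin> q ` {1..m}" "(x, z) \<in> parcs G" for x z z'
    using that by blast+
  show "q i \<in> pverts G" if "1 \<le> i" "i \<le> m" for i using sub that by auto
  show "(q i, q j) \<in> parcs G \<longleftrightarrow> j = Suc i \<or> i = Suc j" "q i = q j \<longleftrightarrow> i = j"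
    if "1 \<le> i" "i \<le> m" "1 \<le> j" "j \<le> m" for i j
    using arc that inj_on_eq_iff[OF i, of i j] by simp_all
  show "x \<in> q ` {1..m} \<or> z \<in> q ` {1..m}" if "x \<in> pverts G" "(x, z) \<in> parcs G" for x z
    using off(1) that by blast
  show "x \<in> q ` {1..m}"
    if "x \<in> pverts G" "(x, z) \<in> parcs G" "(x, z') \<in> parcs G" "z \<noteq> z'" for x z z'
    using off(2) that by blast
qed

lemma dominating_path_closed:
  assumes q: "dominating_path G m q" and G: "pair_graph G"
    and x: "x \<in> q ` {1..m}" "x \<in> L" and L: "\<And>y z. y \<in> L \<Longrightarrow> (y, z) \<in> parcs G \<Longrightarrow> z \<in> L"
  shows "q ` {1..m} \<subseteq> L"
proof -
  obtain i where i: "1 \<le> i" "i \<le> m" "x = q i" using x by auto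
  have up: "i + d \<le> m \<longrightarrow> q (i + d) \<in> L" for d
  proof (induction d)
    case (Suc d)
    then show ?case using L[of "q (i + d)" "q (i + Suc d)"] dominating_pathD(3)[OF q, of "i + d" "i + Suc d"] i
      by auto
  qed (use i x in simp)
  \<comment> \<open>The guard keeps the truncated difference on the path, whose indices start at
    1.\<close>
  have down: "1 \<le> i - d \<longrightarrow> q (i - d) \<in> L" for d
  proof (induction d)
    case (Suc d)
    show ?case
    proof
      assume d: "1 \<le> i - Suc d"
      then have "i - d = Suc (i - Suc d)" by simp
      then have "(q (i - d), q (i - Suc d)) \<in> parcs G"
        using dominating_pathD(3)[OF q, of "i - d" "i - Suc d"] i d by simp
      with Suc d L show "q (i - Suc d) \<in> L" by auto
    qed
  qed (use i x in simp)
  show ?thesis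
  proof
    fix z assume "z \<in> q ` {1..m}"
    then obtain j where j: "1 \<le> j" "j \<le> m" "z = q j" by auto
    show "z \<in> L" using up[of "j - i"] down[of "i - j"] j by (cases "i \<le> j") auto
  qed
qed

text \<open>If \<open>b = p j\<close> with \<open>2 \<le> j\<close> and \<open>j < k\<close>, then
  \<open>T \<ominus> b\<close> has an edge of the spine on either side of the cut. A dominating path
  meets every edge but, being connected, stays on one side.\<close>

lemma dominating_path_del_notin_spine:
  assumes T: "pair_graph T" "spine T k p" and q: "dominating_path (T \<ominus> b) m q"
    and b: "b \<notin> {p 0, p 1, p k, p (Suc k)}"
  shows "b \<notin> p ` {..Suc k}"
proof
  note arc = spineD(5)[OF T(2)] and eq = spineD(6)[OF T(2)] and pin = spineD(3)[OF T(2)]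
  assume "b \<in> p ` {..Suc k}"
  then obtain j where j: "j \<le> Suc k" "b = p j" by auto
  with b have "j \<noteq> 0 \<and> j \<noteq> 1 \<and> j \<noteq> k \<and> j \<noteq> Suc k" by (metis insert_iff)
  then have jk: "2 \<le> j" "j < k" using j by auto
  obtain L where L: "p ` {..<j} \<subseteq> L" "p ` {j<..Suc k} \<inter> L = {}"
    "\<And>x z. x \<in> L \<Longrightarrow> (x, z) \<in> parcs T \<Longrightarrow> z \<noteq> p j \<Longrightarrow> z \<in> L"
    using spine_separation[OF T, of j] jk by auto
  have "(p (j - 1), p (j - 2)) \<in> parcs (T \<ominus> b)" "p (j - 1) \<in> pverts (T \<ominus> b)"
    using jk arc[of "j - 1" "j - 2"] pin[of "j - 1"] pin[of "j - 2"] eq[of "j - 1" j] eq[of "j - 2" j] j(2)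
    by auto
  then have "p (j - 1) \<in> q ` {1..m} \<or> p (j - 2) \<in> q ` {1..m}" by (metis dominating_pathD(5)[OF q])
  moreover have "p (j - 1) \<in> L" "p (j - 2) \<in> L" using L(1) jk by auto
  ultimately obtain x where "x \<in> q ` {1..m}" "x \<in> L" by blast
  then have qL: "q ` {1..m} \<subseteq> L"
    using dominating_path_closed[OF q pair_graph_del[OF T(1)]] L(3) j(2) by (metis parcs_del)
  have "(p (j + 1), p (j + 2)) \<in> parcs (T \<ominus> b)" "p (j + 1) \<in> pverts (T \<ominus> b)"
    using jk arc[of "j + 1" "j + 2"] pin[of "j + 1"] pin[of "j + 2"] eq[of "j + 1" j] eq[of "j + 2" j] j(2)
    by auto
  then have "p (j + 1) \<in> q ` {1..m} \<or> p (j + 2) \<in> q ` {1..m}" by (metis dominating_pathD(5)[OF q])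
  moreover have "p (j + 1) \<in> p ` {j<..Suc k}" "p (j + 2) \<in> p ` {j<..Suc k}" using jk by auto
  then have "p (j + 1) \<notin> L" "p (j + 2) \<notin> L" using L(2) by blast+
  ultimately show False using qL by blast
qed

lemma spine_del:
  assumes T: "spine T k p" and b: "b \<notin> p ` {..Suc k}"
  shows "spine (T \<ominus> b) k p"
proof -
  have pb: "p i \<noteq> b" "b \<noteq> p i" if "i \<le> Suc k" for i using that b by auto
  have "pendants (T \<ominus> b) (p ` {1..k})"
    unfolding pendants_def
  proof (intro conjI ballI)
    show "p ` {1..k} \<subseteq> pverts (T \<ominus> b)" by (rule image_subsetI) (use spineD(3)[OF T] pb in simp)
    fix x assume x: "x \<in> pverts (T \<ominus> b) - p ` {1..k}"
    obtain s where s: "s \<in> p ` {1..k}" "\<And>z. (x, z) \<in> parcs T \<longleftrightarrow> z = s"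
      using pendants_leaf[OF spineD(4)[OF T], of x] x by (metis DiffD1 DiffD2 pverts_del)
    have "s \<noteq> b" using s(1) b by auto
    moreover have "s \<in> pverts T" using s(1) spineD(4)[OF T] by (auto simp: pendants_def)
    ultimately show "\<exists>s\<in>p ` {1..k}. \<forall>z. (x, z) \<in> parcs (T \<ominus> b) \<longleftrightarrow> z = s"
      using s x by auto
  qed
  moreover have "p ` {..Suc k} \<subseteq> pverts (T \<ominus> b)"
    by (rule image_subsetI) (use spineD(3)[OF T] pb in simp)
  moreover have "(p i, p j) \<in> parcs (T \<ominus> b) \<longleftrightarrow> j = Suc i \<or> i = Suc j"
    if "i \<le> Suc k" "j \<le> Suc k" for i j
    using that spineD(3,5)[OF T] pb by simp
  ultimately show ?thesis using spineD(1,2)[OF T] by (simp add: spine_def)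
qed

text \<open>Two paths run through the same vertices. An inner vertex of \<open>q\<close> has two
  neighbours in this set, whereas \<open>p 1\<close> and \<open>p k\<close> have at most one there,
  so they must be ends of \<open>q\<close>.\<close>

lemma path_ends:
  assumes H: "spine H k p"
    and q: "inj_on q {lo..hi}" "q ` {lo..hi} = p ` {1..k}"
    and arc: "\<And>i. lo \<le> i \<Longrightarrow> i < hi \<Longrightarrow> (q i, q (Suc i)) \<in> parcs H \<and> (q (Suc i), q i) \<in> parcs H"
  shows "q lo = p 1 \<and> q hi = p k \<or> q lo = p k \<and> q hi = p 1"
proof -
  note parc = spineD(5)[OF H] and eq = spineD(6)[OF H] and k = spineD(1)[OF H]
  have lohi: "lo \<le> hi" using q(2) k by (metis Icc_eq_Icc atLeastatMost_empty_iff image_is_empty)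
  have e: "\<exists>i. (i = lo \<or> i = hi) \<and> q i = p r" if r: "r = 1 \<or> r = k" for r
  proof -
    have "p r \<in> q ` {lo..hi}" unfolding q(2) using r k by auto
    then obtain i where i: "lo \<le> i" "i \<le> hi" "q i = p r" by auto
    have "\<not> (lo < i \<and> i < hi)"
    proof
      assume l: "lo < i \<and> i < hi"
      then obtain i' where i': "i = Suc i'" by (cases i) auto
      have adj: "(q i, q i') \<in> parcs H" "(q i, q (Suc i)) \<in> parcs H" using arc[of i] arc[of i'] l i' by auto
      have "q i' \<in> p ` {1..k}" "q (Suc i) \<in> p ` {1..k}" using q(2) l i' by auto
      then obtain s t where st: "s \<in> {1..k}" "q i' = p s" "t \<in> {1..k}" "q (Suc i) = p t" by blast
      have "s = Suc r \<or> r = Suc s" "t = Suc r \<or> r = Suc t"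
        using adj st i(3) r k parc[of r s] parc[of r t] by auto
      then have "s = t" using st r by auto
      then have "q i' = q (Suc i)" using st by simp
      then show False using inj_onD[OF q(1), of i' "Suc i"] l i' by auto
    qed
    with i have "i = lo \<or> i = hi" by auto
    with i(3) show ?thesis by blast
  qed
  show ?thesis
  proof (cases "k = 1")
    case True
    then have "q lo \<in> {p 1}" "q hi \<in> {p 1}" using q(2) lohi by auto
    then show ?thesis using True by auto
  next
    case False
    then have "p 1 \<noteq> p k" using eq[of 1 k] k by auto
    then show ?thesis using e[of 1] e[of k] by metis
  qed
qed

text \<open>Skeleton vertices have two neighbours and hence lie on \<open>q\<close>; inner vertices
  of \<open>q\<close> have two neighbours and hence lie on the skeleton. So \<open>q\<close> is the
  skeleton path with at most one leaf added at each end, and \<open>i\<close> records whether one is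
  added at \<open>p 1\<close>. The set \<open>{q 1, q m}\<close> leaves the direction of
  \<open>q\<close> open.\<close>

lemma dominating_path_ends:
  assumes H: "spine H k p" and q: "dominating_path H m q" and m: "2 \<le> m"
  obtains u u' i where "{q 1, q m} = {u, u'}" "u \<in> pverts H" "u' \<in> pverts H" "u \<noteq> u'"
    and "i = 0 \<and> u = p 1 \<or> i = 1 \<and> u \<notin> p ` {1..k} \<and> (u, p 1) \<in> parcs H"
    and "m = i + k \<and> u' = p k \<or> m = Suc (i + k) \<and> u' \<notin> p ` {1..k} \<and> (u', p k) \<in> parcs H"
proof -
  note parc = spineD(5)[OF H] and eq = spineD(6)[OF H] and k = spineD(1)[OF H]
  note qarc = dominating_pathD(3)[OF q] and qeq = dominating_pathD(4)[OF q] and qin = dominating_pathD(2)[OF q]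
  let ?S = "p ` {1..k}"
  have sub: "?S \<subseteq> q ` {1..m}"
  proof
    fix x assume "x \<in> ?S"
    then obtain j where j: "1 \<le> j" "j \<le> k" "x = p j" by auto
    then have "(x, p (Suc j)) \<in> parcs H" "(x, p (j - 1)) \<in> parcs H" "p (Suc j) \<noteq> p (j - 1)" "x \<in> pverts H"
      using parc[of j "Suc j"] parc[of j "j - 1"] eq[of "Suc j" "j - 1"] spineD(3)[OF H] by auto
    then show "x \<in> q ` {1..m}" using dominating_pathD(6)[OF q] by blast
  qed
  have inner: "q i \<in> ?S" if i: "1 < i" "i < m" for i
  proof (rule ccontr)
    assume "q i \<notin> ?S"
    moreover have "(q i, q (i - 1)) \<in> parcs H" "(q i, q (Suc i)) \<in> parcs H" "q (i - 1) \<noteq> q (Suc i)"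
      using i qarc[of i "i - 1"] qarc[of i "Suc i"] qeq[of "i - 1" "Suc i"] by auto
    ultimately show False using spine_leaf[OF H qin[of i]] i by (metis less_imp_le)
  qed
  \<comment> \<open>First and last index at which \<open>q\<close> is on the skeleton; only its two
    ends can be off it.\<close>
  define lo where "lo = (if q 1 \<in> ?S then 1 else 2 :: nat)"
  define hi where "hi = (if q m \<in> ?S then m else m - 1)"
  have lh: "1 \<le> lo" "hi \<le> m" by (auto simp: lo_def hi_def)
  have img: "q ` {lo..hi} = ?S"
  proof
    show "q ` {lo..hi} \<subseteq> ?S"
    proof
      fix x assume "x \<in> q ` {lo..hi}"
      then obtain i where i: "lo \<le> i" "i \<le> hi" "x = q i" by auto
      consider "i = 1" | "i = m" | "1 < i" "i < m" using i lh by linarith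
      then show "x \<in> ?S" using i inner m by cases (auto simp: lo_def hi_def split: if_splits)
    qed
    show "?S \<subseteq> q ` {lo..hi}"
    proof
      fix x assume x: "x \<in> ?S"
      with sub have "x \<in> q ` {1..m}" by blast
      then obtain i where i: "1 \<le> i" "i \<le> m" "x = q i" by auto
      then have "lo \<le> i" "i \<le> hi" using x by (cases "i = 1"; cases "i = m"; auto simp: lo_def hi_def)+
      with i show "x \<in> q ` {lo..hi}" by auto
    qed
  qed
  have inj: "inj_on q {lo..hi}"
    using dominating_pathD(1)[OF q] by (rule inj_on_subset) (use lh in auto)
  have "card {lo..hi} = card {1..k}"
    using card_image[OF inj] card_image[of p "{1..k}"] inj_on_subset[OF spineD(2)[OF H], of "{1..k}"] img
    by auto
  then have card: "Suc hi - lo = k" by simp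
  have q1: "q 1 \<notin> ?S \<Longrightarrow> (q 1, q lo) \<in> parcs H" "q m \<notin> ?S \<Longrightarrow> (q m, q hi) \<in> parcs H"
    using qarc[of 1 2] qarc[of m "m - 1"] m by (auto simp: lo_def hi_def)
  have V: "q 1 \<in> pverts H" "q m \<in> pverts H" "q 1 \<noteq> q m" using qin[of 1] qin[of m] qeq[of 1 m] m by auto
  \<comment> \<open>The two directions of \<open>q\<close>; accordingly \<open>i\<close> is
    \<open>lo - 1\<close> or \<open>m - hi\<close>.\<close>
  consider "q lo = p 1" "q hi = p k" | "q lo = p k" "q hi = p 1"
    using path_ends[OF H inj img] qarc lh by fastforce
  then show thesis
  proof cases
    case 1
    show thesis
    proof (rule that[of "q 1" "q m" "lo - 1"])
      show "lo - 1 = 0 \<and> q 1 = p 1 \<or> lo - 1 = 1 \<and> q 1 \<notin> ?S \<and> (q 1, p 1) \<in> parcs H"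
        using 1 q1(1) by (auto simp: lo_def split: if_splits)
      show "m = lo - 1 + k \<and> q m = p k \<or> m = Suc (lo - 1 + k) \<and> q m \<notin> ?S \<and> (q m, p k) \<in> parcs H"
        using 1 q1(2) card lh(1) k m by (cases "q m \<in> ?S") (auto simp: hi_def)
    qed (use V in auto)
  next
    case 2
    show thesis
    proof (rule that[of "q m" "q 1" "m - hi"])
      show "m - hi = 0 \<and> q m = p 1 \<or> m - hi = 1 \<and> q m \<notin> ?S \<and> (q m, p 1) \<in> parcs H"
        using 2 q1(2) m by (cases "q m \<in> ?S") (auto simp: hi_def)
      show "m = m - hi + k \<and> q 1 = p k \<or> m = Suc (m - hi + k) \<and> q 1 \<notin> ?S \<and> (q 1, p k) \<in> parcs H"
        using 2 q1(1) card lh(2) k m by (cases "q 1 \<in> ?S") (auto simp: lo_def)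
    qed (use V in auto)
  qed
qed

section \<open>Normal form of the isomorphisms between cards\<close>

lemma is_isomorphism_twin_swap:
  assumes "pair_graph H" "x \<in> pverts H" "x' \<in> pverts H"
    and twin: "\<And>z. (x, z) \<in> parcs H \<longleftrightarrow> (x', z) \<in> parcs H"
  shows "is_isomorphism (transpose x x') H H"
proof -
  have sym: "(s, t) \<in> parcs H \<longleftrightarrow> (t, s) \<in> parcs H" for s t
    using assms(1) unfolding pair_graph_iff by blast
  then have twin': "(z, x) \<in> parcs H \<longleftrightarrow> (z, x') \<in> parcs H" for z
    using sym[of z x] sym[of z x'] twin[of z] by blast
  have "bij_betw (transpose x x') (pverts H) (pverts H)"
    using assms(2,3) by (intro permutes_imp_bij permutes_swap_id)
  moreover have "(transpose x x' s, z) \<in> parcs H \<longleftrightarrow> (s, z) \<in> parcs H" for s z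
    using twin[of z] unfolding transpose_def by (cases "s = x"; cases "s = x'") simp_all
  moreover have "(z, transpose x x' s) \<in> parcs H \<longleftrightarrow> (z, s) \<in> parcs H" for s z
    using twin'[of z] unfolding transpose_def by (cases "s = x"; cases "s = x'") simp_all
  ultimately show ?thesis by (simp add: is_isomorphism_def)
qed

text \<open>The index \<open>e\<close> is that of the end leaf of the spine at \<open>p r\<close>. A
  leaf \<open>u\<close> at \<open>p r\<close> has the same neighbourhood as \<open>p e\<close>, so
  the two may be exchanged.\<close>

lemma spine_normalise_end:
  assumes H: "pair_graph H" "spine H k p" and r: "r \<in> {1..k}" and e: "e = 0 \<and> r = 1 \<or> e = Suc k \<and> r = k"
    and u: "u \<in> pverts H" "u \<notin> p ` {1..k}" "(u, p r) \<in> parcs H"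
  shows "is_isomorphism (transpose u (p e)) H H"
proof (rule is_isomorphism_twin_swap[OF H(1) u(1)])
  have e_le: "e \<le> Suc k" using e by auto
  then show pe: "p e \<in> pverts H" by (rule spineD(3)[OF H(2)])
  have "p e \<notin> p ` {1..k}" "(p e, p r) \<in> parcs H"
    using spine_end_notin[OF H(2)] e r spineD(5)[OF H(2), of e r] by auto
  then show "(u, z) \<in> parcs H \<longleftrightarrow> (p e, z) \<in> parcs H" for z
    using spine_leaf[OF H(2) u] spine_leaf[OF H(2) pe] by blast
qed

text \<open>Leaves at the same vertex are interchangeable: one transposition moves \<open>u\<close>
  to \<open>p 0\<close> if it is a leaf, a second one moves the other end to
  \<open>p (Suc k)\<close> if that is a leaf.\<close>

lemma spine_normalise_ends:
  assumes H: "pair_graph H" "spine H k p"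
    and u: "u \<in> pverts H" "u' \<in> pverts H" "u \<noteq> u'"
    and i: "i = 0 \<and> u = p 1 \<or> i = 1 \<and> u \<notin> p ` {1..k} \<and> (u, p 1) \<in> parcs H"
    and m: "m = i + k \<and> u' = p k \<or> m = Suc (i + k) \<and> u' \<notin> p ` {1..k} \<and> (u', p k) \<in> parcs H"
  shows "\<exists>s. is_isomorphism s H H \<and> s u = p (1 - i) \<and> s u' = p (m - i)"
proof -
  note k = spineD(1)[OF H(2)] and eq = spineD(6)[OF H(2)] and en = spine_end_notin[OF H(2)]
  have pS: "p j \<in> p ` {1..k}" if "j = 1 \<or> j = k" for j using that k by auto
  \<comment> \<open>The last two facts ensure that a leaf \<open>u'\<close> at \<open>p k\<close> is
    still sent to a leaf at \<open>p k\<close>.\<close>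
  obtain s where s: "is_isomorphism s H H" "s u = p (1 - i)"
    "\<And>j. j = 1 \<or> j = k \<Longrightarrow> s (p j) = p j" "\<And>x. x \<in> p ` {1..k} \<longleftrightarrow> s x \<in> p ` {1..k}"
  proof (cases "i = 0")
    case True
    then show thesis using i by (intro that[of id]) (auto simp: is_isomorphism_id)
  next
    case False
    with i have i': "i = 1" "u \<notin> p ` {1..k}" "(u, p 1) \<in> parcs H" by auto
    show thesis
    proof (rule that[of "transpose u (p 0)"])
      show "is_isomorphism (transpose u (p 0)) H H"
        using spine_normalise_end[OF H, of 1 0 u] k i' u(1) by simp
      show "transpose u (p 0) u = p (1 - i)" using i' by simp
      show "transpose u (p 0) (p j) = p j" if "j = 1 \<or> j = k" for j
        using pS[OF that] i'(2) en(1) by (metis transpose_apply_other)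
      show "x \<in> p ` {1..k} \<longleftrightarrow> transpose u (p 0) x \<in> p ` {1..k}" for x
        using i'(2) en(1) by (metis transpose_apply_first transpose_apply_other transpose_apply_second)
    qed
  qed
  have sinj: "inj_on s (pverts H)" and simg: "s ` pverts H = pverts H"
    and sarc: "\<And>x y. x \<in> pverts H \<Longrightarrow> y \<in> pverts H \<Longrightarrow> (s x, s y) \<in> parcs H \<longleftrightarrow> (x, y) \<in> parcs H"
    using s(1) by (auto simp: is_isomorphism_def bij_betw_def)
  show ?thesis
  proof (cases "m = i + k")
    case True
    then show ?thesis using m s by auto
  next
    case False
    with m have m': "m = Suc (i + k)" "u' \<notin> p ` {1..k}" "(u', p k) \<in> parcs H" by auto
    \<comment> \<open>The swap concerns \<open>s u'\<close>, not \<open>u'\<close>: for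
      \<open>k = 1\<close> the first swap may have moved \<open>u'\<close>, as \<open>u'\<close> may
      be \<open>p 0\<close>.\<close>
    let ?t = "transpose (s u') (p (Suc k))"
    have su': "s u' \<in> pverts H" "s u' \<notin> p ` {1..k}" using simg u(2) s(4) m'(2) by auto
    have "(s u', s (p k)) \<in> parcs H" using sarc u(2) m'(3) spineD(3)[OF H(2), of k] by simp
    then have "(s u', p k) \<in> parcs H" using s(3) by simp
    then have "is_isomorphism ?t H H"
      using spine_normalise_end[OF H, of k "Suc k" "s u'"] su' k by simp
    \<comment> \<open>The second swap thus leaves \<open>s u = p (1 - i)\<close> in place, as it
      differs from both exchanged vertices.\<close>
    moreover have "s u \<noteq> s u'" using sinj u by (auto dest: inj_onD)
    moreover have "p (1 - i) \<noteq> p (Suc k)" using eq[of "1 - i" "Suc k"] k by auto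
    ultimately have "is_isomorphism (?t \<circ> s) H H" "(?t \<circ> s) u = p (1 - i)" "(?t \<circ> s) u' = p (m - i)"
      using is_isomorphism_comp[OF s(1)] s(2) m'(1) by (simp_all add: transpose_apply_other)
    then show ?thesis by blast
  qed
qed

text \<open>Deleting \<open>y 0\<close> opens the cycle to the path through \<open>y 1\<close> up to
  \<open>y (c - 1)\<close>. All other vertices were leaves; they keep their neighbour unless it is
  \<open>y 0\<close>.\<close>

lemma card_iso_dominating_path:
  assumes U: "pair_graph U" "pendants U S" "cycle_labelling (induced U S) c y"
    and f: "is_isomorphism f (U \<ominus> y 0) H" and H: "pair_graph H"
  shows "dominating_path H (c - 1) (f \<circ> y)"
proof -
  note c = cycle_labelling_inducedD(1)[OF U(3)] and b = cycle_labelling_inducedD(2)[OF U(3)]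
  have finj: "inj_on f (pverts U - {y 0})" and fimg: "f ` (pverts U - {y 0}) = pverts H"
    and farc: "\<And>s t. s \<in> pverts U - {y 0} \<Longrightarrow> t \<in> pverts U - {y 0} \<Longrightarrow>
      (f s, f t) \<in> parcs H \<longleftrightarrow> (s, t) \<in> parcs U"
    using f by (auto simp: is_isomorphism_def bij_betw_def)
  have yin: "y i \<in> S" "y i \<in> pverts U" if "i < c" for i
    using b U(2) that by (auto simp: bij_betw_def pendants_def)
  have yeq: "y i = y j \<longleftrightarrow> i = j" if "i < c" "j < c" for i j
    using b that by (auto simp: bij_betw_def dest: inj_onD)
  have yi: "y i \<in> pverts U - {y 0}" if "i \<in> {1..c - 1}" for i
  proof -
    have "i < c" "i \<noteq> 0" using that c by auto
    then show ?thesis using yin[of i] yeq[of i 0] by auto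
  qed
  have "inj_on y {1..c - 1}"
    by (rule inj_on_subset[OF bij_betw_imp_inj_on[OF b]]) (use c in auto)
  moreover have "y ` {1..c - 1} \<subseteq> pverts U - {y 0}" by (rule image_subsetI) (rule yi)
  ultimately have "inj_on (f \<circ> y) {1..c - 1}" using comp_inj_on inj_on_subset[OF finj] by blast
  moreover have sub: "(f \<circ> y) ` {1..c - 1} \<subseteq> pverts H" using fimg yi by auto
  moreover have arc: "((f \<circ> y) i, (f \<circ> y) j) \<in> parcs H \<longleftrightarrow> j = Suc i \<or> i = Suc j"
    if "i \<in> {1..c - 1}" "j \<in> {1..c - 1}" for i j
  proof -
    have "((f \<circ> y) i, (f \<circ> y) j) \<in> parcs H \<longleftrightarrow> (y i, y j) \<in> parcs U"
      using farc yi that by simp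
    also have "\<dots> \<longleftrightarrow> j = (i + 1) mod c \<or> i = (j + 1) mod c"
      using cycle_labelling_induced_arc_iff[OF U(3), of i j] that c by auto
    \<comment> \<open>The wrap-around successor of \<open>c - 1\<close> is 0, outside the range of
      the path.\<close>
    also have "\<dots> \<longleftrightarrow> j = Suc i \<or> i = Suc j"
    proof -
      have "(l + 1) mod c = (if l = c - 1 then 0 else Suc l)" if "l \<in> {1..c - 1}" for l
        using that c by auto
      then show ?thesis using that c by auto
    qed
    finally show ?thesis .
  qed
  moreover have "\<forall>i\<in>{1..c - 1}. \<forall>j\<in>{1..c - 1}.
      ((f \<circ> y) i, (f \<circ> y) j) \<in> parcs H \<longleftrightarrow> j = Suc i \<or> i = Suc j"
    using arc by (intro ballI)
  moreover have off: "z \<in> (f \<circ> y) ` {1..c - 1} \<and> (\<forall>z'. (x, z') \<in> parcs H \<longrightarrow> z' = z)"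
    if x: "x \<in> pverts H" "x \<notin> (f \<circ> y) ` {1..c - 1}" and xz: "(x, z) \<in> parcs H" for x z
  proof -
    obtain x0 where x0: "x0 \<in> pverts U - {y 0}" "x = f x0" using x(1) fimg by auto
    have "x0 \<notin> S"
    proof
      assume "x0 \<in> S"
      then obtain i where i: "i < c" "x0 = y i" using b by (auto simp: bij_betw_def)
      then have "i \<in> {1..c - 1}" using x0(1) by (cases "i = 0") auto
      with i x x0 show False by auto
    qed
    then obtain s where s: "s \<in> S" "\<And>t. (x0, t) \<in> parcs U \<longleftrightarrow> t = s"
      using pendants_leaf[OF U(2), of x0] x0(1) by blast
    have img: "\<exists>t. t \<in> pverts U - {y 0} \<and> z' = f t \<and> t = s" if z': "(x, z') \<in> parcs H" for z'
    proof -
      have "z' \<in> pverts H" using z' H unfolding pair_graph_iff by blast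
      then obtain t where t: "t \<in> pverts U - {y 0}" "z' = f t" using fimg by auto
      have "(x0, t) \<in> parcs U" using farc[OF x0(1) t(1)] z' x0(2) t(2) by simp
      then show ?thesis using s(2)[of t] t by simp
    qed
    have zs: "s \<in> pverts U - {y 0}" "z = f s" using img[OF xz] by auto
    moreover obtain i where i: "i < c" "s = y i" using s(1) b by (auto simp: bij_betw_def)
    ultimately have "i \<in> {1..c - 1}" by (cases "i = 0") auto
    then have "z \<in> (f \<circ> y) ` {1..c - 1}" using i \<open>z = f s\<close> by auto
    moreover have "z' = z" if "(x, z') \<in> parcs H" for z' using img[OF that] zs(2) by auto
    ultimately show ?thesis by blast
  qed
  have "\<forall>x\<in>pverts H - (f \<circ> y) ` {1..c - 1}. \<forall>z. (x, z) \<in> parcs H \<longrightarrow>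
      z \<in> (f \<circ> y) ` {1..c - 1} \<and> (\<forall>z'. (x, z') \<in> parcs H \<longrightarrow> z' = z)"
    using off by (intro ballI allI impI) (elim DiffE)
  ultimately show ?thesis unfolding dominating_path_def by (intro conjI)
qed

text \<open>Comparing \<open>U \<ominus> a\<close> with \<open>T \<ominus> b\<close> locates both
  vertices: a cycle cannot survive in \<open>T\<close>, and \<open>T \<ominus> b\<close> has no
  isolated vertex. The given \<open>f\<close> is then composed with an automorphism of
  \<open>T \<ominus> b\<close> that moves the neighbours of \<open>a\<close> to standard places on
  the spine.\<close>

lemma card_iso_normal_form:
  assumes U: "pair_graph U" "pendants U S" "cycle_labelling (induced U S) c y"
    and T: "pair_graph T" "spine T k p"
    and f: "is_isomorphism f (U \<ominus> a) (T \<ominus> b)"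
    and a: "a \<in> pverts U" and b: "b \<notin> {p 0, p 1, p k, p (Suc k)}"
  obtains g i where "is_isomorphism g (U \<ominus> a) (T \<ominus> b)" "i \<le> 1" "k \<le> c - 1 - i" "c - 1 - i \<le> Suc k"
    and "g ` {z. (a, z) \<in> parcs U} = {p (1 - i), p (c - 1 - i)}" and "b \<notin> p ` {..Suc k}"
proof -
  let ?H = "T \<ominus> b"
  note c = cycle_labelling_inducedD(1)[OF U(3)]
  have H: "pair_graph ?H" using T(1) by (rule pair_graph_del)
  have fimg: "f ` (pverts U - {a}) = pverts T - {b}"
    and farc: "\<And>s t. s \<in> pverts U - {a} \<Longrightarrow> t \<in> pverts U - {a} \<Longrightarrow>
      (f s, f t) \<in> parcs ?H \<longleftrightarrow> (s, t) \<in> parcs U"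
    and finj: "inj_on f (pverts U - {a})"
    using f unfolding is_isomorphism_def by (simp_all add: bij_betw_def)
  have SU: "S \<subseteq> pverts U" using U(2) by (simp add: pendants_def)
  \<comment> \<open>Otherwise the whole cycle survives and is mapped into the caterpillar
    \<open>T\<close>.\<close>
  have "a \<in> S"
  proof (rule ccontr)
    assume aS: "a \<notin> S"
    then have S: "S \<subseteq> pverts U - {a}" using SU by blast
    show False
    proof (rule spine_acyclic[OF T(2), of "f ` S"])
      show "f ` S \<subseteq> pverts T" using S fimg by blast
      show "f ` S \<noteq> {}"
        using cycle_labelling_inducedD[OF U(3)] by (auto simp: bij_betw_def lessThan_empty_iff)
      fix x assume "x \<in> f ` S"
      then obtain x0 where x0: "x0 \<in> S" "x = f x0" by blast
      obtain s t where st: "s \<in> S" "t \<in> S" "s \<noteq> t" "(x0, s) \<in> parcs U" "(x0, t) \<in> parcs U"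
        using cycle_labelling_two_neighbours[OF U(3) x0(1)] .
      have "f s \<noteq> f t" using st S finj by (meson inj_onD subsetD)
      moreover have "(x, f s) \<in> parcs T" "(x, f t) \<in> parcs T"
        using st S x0 farc[of x0 s] farc[of x0 t] by auto
      ultimately show "\<exists>s\<in>f ` S. \<exists>t\<in>f ` S. s \<noteq> t \<and> (x, s) \<in> parcs T \<and> (x, t) \<in> parcs T"
        using st by blast
    qed
  qed
  then obtain j where j: "j < c" "a = y j"
    using cycle_labelling_inducedD[OF U(3)] by (auto simp: bij_betw_def)
  \<comment> \<open>The cycle is rotated so that \<open>a\<close> gets index 0.\<close>
  define y' where "y' i = y ((i + j) mod c)" for i
  have y': "cycle_labelling (induced U S) c y'" unfolding y'_def by (rule cycle_labelling_rotate[OF U(3) j(1)])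
  have a': "a = y' 0" using j by (simp add: y'_def)
  have q: "dominating_path ?H (c - 1) (f \<circ> y')"
    using card_iso_dominating_path[OF U(1,2) y'] f H a' by blast
  have bp: "b \<notin> p ` {..Suc k}" using dominating_path_del_notin_spine[OF T q b] .
  have Hp: "spine ?H k p" using spine_del[OF T(2) bp] .
  have nbrs: "{z. (a, z) \<in> parcs U} = {y' 1, y' (c - 1)}"
  proof
    show "{y' 1, y' (c - 1)} \<subseteq> {z. (a, z) \<in> parcs U}"
      using cycle_labelling_induced_arc_iff[OF y', of 0 1] cycle_labelling_induced_arc_iff[OF y', of 0 "c - 1"] c a'
      by auto
    show "{z. (a, z) \<in> parcs U} \<subseteq> {y' 1, y' (c - 1)}"
    proof
      fix z assume "z \<in> {z. (a, z) \<in> parcs U}"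
      then have az: "(a, z) \<in> parcs U" by simp
      then have za: "(z, a) \<in> parcs U" "z \<in> pverts U" "z \<noteq> a" using U(1) unfolding pair_graph_iff by blast+
      \<comment> \<open>A leaf at \<open>a\<close> would be isolated in
        \<open>U \<ominus> a\<close>, but every vertex of a graph with a spine has a neighbour. So
        \<open>a\<close> has only its two neighbours on the cycle.\<close>
      have "z \<in> S"
      proof (rule ccontr)
        assume zS: "z \<notin> S"
        have "f z \<in> pverts ?H" using fimg za by auto
        then obtain t where t: "(f z, t) \<in> parcs ?H" using spine_has_neighbour[OF Hp] by blast
        then have "t \<in> pverts ?H" using H unfolding pair_graph_iff by blast
        then obtain t0 where "t0 \<in> pverts U - {a}" "t = f t0" using fimg by auto
        with t farc za have "(z, t0) \<in> parcs U" "t0 \<noteq> a" by auto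
        then show False using pendants_leaf[OF U(2) za(2) zS] za(1) by metis
      qed
      then obtain l where l: "l < c" "z = y' l"
        using cycle_labelling_inducedD[OF y'] by (auto simp: bij_betw_def)
      then have "l = 1 mod c \<or> 0 = Suc l mod c"
        using cycle_labelling_induced_arc_iff[OF y', of 0 l] az a' c by auto
      then have "l = 1 \<or> l = c - 1" using l c by (auto simp: mod_Suc split: if_splits)
      with l show "z \<in> {y' 1, y' (c - 1)}" by auto
    qed
  qed
  have "2 \<le> c - 1" using c by simp
  from dominating_path_ends[OF Hp q this]
  obtain u u' i where u: "{(f \<circ> y') 1, (f \<circ> y') (c - 1)} = {u, u'}" "u \<in> pverts ?H" "u' \<in> pverts ?H" "u \<noteq> u'"
    and i: "i = 0 \<and> u = p 1 \<or> i = 1 \<and> u \<notin> p ` {1..k} \<and> (u, p 1) \<in> parcs ?H"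
    and m: "c - 1 = i + k \<and> u' = p k \<or> c - 1 = Suc (i + k) \<and> u' \<notin> p ` {1..k} \<and> (u', p k) \<in> parcs ?H" .
  obtain s where s: "is_isomorphism s ?H ?H" "s u = p (1 - i)" "s u' = p (c - 1 - i)"
    using spine_normalise_ends[OF H Hp u(2-4) i m] by blast
  show thesis
  proof (rule that[of "s \<circ> f" i])
    show "is_isomorphism (s \<circ> f) (U \<ominus> a) ?H" using f s(1) by (rule is_isomorphism_comp)
    have "(s \<circ> f) ` {z. (a, z) \<in> parcs U} = s ` {u, u'}" using u(1) nbrs by (metis comp_def image_comp image_empty image_insert)
    then show "(s \<circ> f) ` {z. (a, z) \<in> parcs U} = {p (1 - i), p (c - 1 - i)}" using s by simp
    show "i \<le> 1" using i by auto
    show "k \<le> c - 1 - i" "c - 1 - i \<le> Suc k" using m by linarith+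
  qed (rule bp)
qed

section \<open>Saturating sets and supercards\<close>

text \<open>Since \<open>f\<close> maps \<open>inv f v\<close> to \<open>v\<close>, deleting these
  two vertices from the given isomorphism yields the condition of \<open>B_vw\<close>, as deletions
  commute.\<close>

lemma B_U_memI:
  assumes f: "f permutes pverts G" "is_isomorphism f (G \<ominus> w) (G \<ominus> f w)"
    and v: "inv f v \<in> pverts G" "inv f v \<noteq> w"
  shows "f \<in> B_U G w v"
proof -
  have "is_isomorphism f ((G \<ominus> w) \<ominus> inv f v) ((G \<ominus> f w) \<ominus> f (inv f v))"
    using is_isomorphism_del[OF f(2), of "inv f v"] v by simp
  then have "is_isomorphism f ((G \<ominus> w) \<ominus> inv f v) ((G \<ominus> v) \<ominus> f w)"
    by (simp add: permutes_inverses[OF f(1)] del_commute)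
  with f show ?thesis by (simp add: B_U_def B_vw_def)
qed

text \<open>Condition (3) of a maximum saturating set is maximality under inclusion. There are only
  finitely many permutations, so \<open>Y\<close> extends to such a set \<open>X\<close>, and all of
  \<open>Y\<close> counts in the intersection of \<open>X\<close> with
  \<open>B_U G w v\<close>.\<close>

lemma card_le_chi:
  assumes fin: "finite (pverts G)" and Y: "Y \<subseteq> B_U G w v" "id \<in> Y" "saturating w v Y"
  shows "card Y \<le> chi G w v"
proof -
  have finB: "finite (B_vw G w v)"
    by (rule finite_subset[OF _ finite_permutations[OF fin]]) (auto simp: B_vw_def)
  let ?F = "{X. X \<subseteq> B_vw G w v \<and> id \<in> X \<and> saturating w v X}"
  have "finite ?F" by (rule finite_subset[of _ "Pow (B_vw G w v)"]) (use finB in auto)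
  moreover have "Y \<in> ?F" using Y by (auto simp: B_U_def)
  ultimately have "\<exists>X\<in>?F. Y \<subseteq> X \<and> (\<forall>Z\<in>?F. X \<subseteq> Z \<longrightarrow> X = Z)"
    by (rule finite_has_maximal2)
  then obtain X where X: "X \<in> ?F" "Y \<subseteq> X" and maxX: "\<forall>Z\<in>?F. X \<subseteq> Z \<longrightarrow> X = Z" by (elim bexE conjE)
  have "\<not> saturating w v (insert s X)" if s: "s \<in> B_vw G w v - X" for s
  proof
    assume "saturating w v (insert s X)"
    then have "insert s X \<in> ?F" using X(1) s by simp
    from bspec[OF maxX this] have "X = insert s X" by (simp add: subset_insertI)
    then have "s \<in> X" by (rule ssubst) simp
    with s show False by simp
  qed
  then have max: "max_saturating G w v X" using X(1) by (auto simp: max_saturating_def)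
  \<comment> \<open>Finiteness makes the \<open>Max\<close> in \<open>chi\<close> an upper
    bound.\<close>
  have "finite {card (X \<inter> B_U G w v) | X. max_saturating G w v X}"
    by (rule finite_subset[of _ "(\<lambda>X. card (X \<inter> B_U G w v)) ` Pow (B_vw G w v)"])
      (use finB in \<open>auto simp: max_saturating_def\<close>)
  then have "card (X \<inter> B_U G w v) \<le> chi G w v"
    unfolding chi_def using max by (intro Max_ge) auto
  moreover have "card Y \<le> card (X \<inter> B_U G w v)"
    using X(1,2) Y(1) finB by (intro card_mono) (auto intro: finite_subset)
  ultimately show ?thesis by simp
qed

text \<open>With \<open>w = h a0\<close>, the map \<open>F a0\<close> identifies \<open>U\<close>
  with \<open>G \<ominus> w\<close>. Seen through it, each \<open>F a\<close> becomes a permutation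
  \<open>L a\<close> of the vertices in \<open>B_U\<close>, and distinct \<open>a\<close> differ in
  both ways that a saturating set demands.\<close>

lemma card_le_chi_if_isos:
  assumes G: "finite (pverts G)" "v \<in> pverts G"
    and A: "A \<subseteq> pverts U" "a0 \<in> A" "inj_on h A"
    and h: "\<And>a. a \<in> A \<Longrightarrow> h a \<in> pverts G"
    and F: "\<And>a. a \<in> A \<Longrightarrow> is_isomorphism (F a) U (G \<ominus> h a)" "\<And>a. a \<in> A \<Longrightarrow> F a a = v"
  shows "card A \<le> chi G (h a0) v"
proof -
  define w where "w = h a0"
  define e where "e = inv_into (pverts U) (F a0)"
  \<comment> \<open>The missing vertex \<open>w\<close> goes to the vertex \<open>h a\<close> missed
    by \<open>F a\<close>; outside the graph the map is the identity, as \<open>permutes\<close>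
    requires.\<close>
  define L where "L a x = (if x = w then h a else if x \<in> pverts G then F a (e x) else x)" for a x
  have F0: "bij_betw (F a0) (pverts U) (pverts G - {w})"
    using F(1)[OF A(2)] by (simp add: is_isomorphism_def w_def)
  have e: "is_isomorphism e (G \<ominus> w) U"
    unfolding e_def w_def by (rule is_isomorphism_inv_into[OF F(1)[OF A(2)]])
  have eF0: "e (F a0 x) = x" if "x \<in> pverts U" for x
    unfolding e_def using F0 that by (simp add: bij_betw_inv_into_left)
  have w: "w \<in> pverts G" using h[OF A(2)] by (simp add: w_def)
  have Liso: "is_isomorphism (L a) (G \<ominus> w) (G \<ominus> h a)" if a: "a \<in> A" for a
  proof -
    have "is_isomorphism (F a \<circ> e) (G \<ominus> w) (G \<ominus> h a)"
      using e F(1)[OF a] by (rule is_isomorphism_comp)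
    then show ?thesis by (subst is_isomorphism_cong[where g = "F a \<circ> e"]) (auto simp: L_def)
  qed
  have Lperm: "L a permutes pverts G" if a: "a \<in> A" for a
  proof (rule bij_imp_permutes)
    have "bij_betw (L a) (pverts G - {w}) (pverts G - {h a})"
      using Liso[OF a] by (simp add: is_isomorphism_def)
    then have "bij_betw (L a) (pverts G - {w} \<union> {w}) (pverts G - {h a} \<union> {L a w})"
      by (rule notIn_Un_bij_betw[rotated 2]) (auto simp: L_def)
    then show "bij_betw (L a) (pverts G) (pverts G)"
      using w h[OF a] by (simp add: L_def insert_absorb)
    show "L a x = x" if "x \<notin> pverts G" for x using that w by (auto simp: L_def)
  qed
  have Lw: "L a w = h a" for a by (simp add: L_def)
  have F0in: "F a0 a \<in> pverts G" "F a0 a \<noteq> w" if "a \<in> A" for a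
    using F0 A(1) that by (auto simp: bij_betw_def)
  \<comment> \<open>As \<open>F a a = v\<close>, the preimage of \<open>v\<close> is the copy of
    \<open>a\<close> in \<open>G \<ominus> w\<close>; injectivity of \<open>F a0\<close> separates
    these preimages.\<close>
  have Linv: "inv (L a) v = F a0 a" if a: "a \<in> A" for a
  proof -
    have "L a (F a0 a) = v"
      using F0in[OF a] eF0[of a] A(1) a F(2)[OF a] by (auto simp: L_def)
    then show ?thesis using permutes_inverses(2)[OF Lperm[OF a]] by metis
  qed
  have L0: "L a0 = id"
  proof
    fix x
    have "F a0 (e x) = x" if "x \<in> pverts G" "x \<noteq> w"
      unfolding e_def using F0 that by (simp add: bij_betw_inv_into_right)
    then show "L a0 x = id x" by (simp add: L_def w_def)
  qed
  have "inj_on L A"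
    using A(3) Lw by (metis inj_on_def)
  then have "card A = card (L ` A)" by (simp add: card_image)
  also have "\<dots> \<le> chi G w v"
  proof (rule card_le_chi[OF G(1)])
    show "L ` A \<subseteq> B_U G w v"
    proof (rule image_subsetI)
      fix a assume a: "a \<in> A"
      show "L a \<in> B_U G w v"
        using Lperm[OF a] Liso[OF a] F0in[OF a] unfolding Linv[OF a, symmetric] Lw[of a, symmetric]
        by (rule B_U_memI)
    qed
    show "id \<in> L ` A" using L0 A(2) by (metis imageI)
    have "inv (L a) v \<noteq> inv (L b) v \<and> L a w \<noteq> L b w" if "a \<in> A" "b \<in> A" "a \<noteq> b" for a b
    proof
      show "L a w \<noteq> L b w" using A(3) that Lw by (auto dest: inj_onD)
      show "inv (L a) v \<noteq> inv (L b) v"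
        using Linv that A(1) F0 by (metis bij_betw_def inj_onD subsetD)
    qed
    then show "saturating w v (L ` A)" unfolding saturating_def by blast
  qed
  finally show ?thesis by (simp add: w_def)
qed

section \<open>Closing a path of the caterpillar to a cycle through a new vertex\<close>

definition attach :: "'a ugraph \<Rightarrow> 'a \<Rightarrow> 'a set \<Rightarrow> 'a ugraph" where
  "attach T v E = \<lparr>pverts = insert v (pverts T), parcs = parcs T \<union> {v} \<times> E \<union> E \<times> {v}\<rparr>"

lemma pverts_attach [simp]: "pverts (attach T v E) = insert v (pverts T)"
  by (simp add: attach_def)

lemma parcs_attach:
  "(x, y) \<in> parcs (attach T v E) \<longleftrightarrow> (x, y) \<in> parcs T \<or> x = v \<and> y \<in> E \<or> x \<in> E \<and> y = v"
  by (auto simp: attach_def)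

lemma pair_graph_attach:
  assumes "pair_graph T" "E \<subseteq> pverts T" "v \<notin> pverts T"
  shows "pair_graph (attach T v E)"
  unfolding pair_graph_iff
proof (intro conjI allI impI)
  show "finite (pverts (attach T v E))" using assms(1) by (simp add: pair_graph_iff)
  fix x y assume "(x, y) \<in> parcs (attach T v E)"
  then consider "(x, y) \<in> parcs T" | "x = v" "y \<in> E" | "x \<in> E" "y = v" by (auto simp: parcs_attach)
  then show "x \<in> pverts (attach T v E)" "y \<noteq> x" "(y, x) \<in> parcs (attach T v E)"
    using assms by (cases; auto simp: parcs_attach dest: pair_graph_parcsD)+
qed

lemma attach_del:
  assumes "pair_graph T" "v \<notin> pverts T"
  shows "attach T v E \<ominus> v = T"
proof -
  have "parcs (attach T v E \<ominus> v) = parcs T"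
    using assms pair_graph_parcsD[OF assms(1)] by (auto simp: parcs_attach)
  moreover have "pverts (attach T v E \<ominus> v) = pverts T" using assms(2) by simp
  ultimately show ?thesis by simp
qed

text \<open>The new vertex \<open>v\<close> takes the place of \<open>a\<close>: it is joined
  exactly to the images of the neighbours of \<open>a\<close>, so \<open>g\<close> extends by
  sending \<open>a\<close> to \<open>v\<close>.\<close>

lemma is_isomorphism_attach:
  assumes U: "pair_graph U" "a \<in> pverts U" and T: "pair_graph T" "v \<notin> pverts T" "b \<in> pverts T"
    and g: "is_isomorphism g (U \<ominus> a) (T \<ominus> b)" and E: "g ` {z. (a, z) \<in> parcs U} = E"
  shows "is_isomorphism (g(a := v)) U (attach T v E \<ominus> b)"
proof -
  let ?H = "attach T v E \<ominus> b"
  have gb: "bij_betw g (pverts U - {a}) (pverts T - {b})"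
    and garc: "\<And>s t. s \<in> pverts U - {a} \<Longrightarrow> t \<in> pverts U - {a} \<Longrightarrow>
      (s, t) \<in> parcs U \<longleftrightarrow> (g s, g t) \<in> parcs (T \<ominus> b)"
    using g unfolding is_isomorphism_def by simp_all
  have gin: "g s \<in> pverts T" "g s \<noteq> b" "g s \<noteq> v" if "s \<in> pverts U" "s \<noteq> a" for s
    using gb that T(2) by (auto simp: bij_betw_def)
  have "bij_betw (g(a := v)) (pverts U - {a}) (pverts T - {b})"
    using gb by (subst bij_betw_cong[where g = g]) auto
  then have "bij_betw (g(a := v)) (pverts U - {a} \<union> {a}) (pverts T - {b} \<union> {(g(a := v)) a})"
    by (rule notIn_Un_bij_betw[rotated 2]) (use T(2) in auto)
  then have bij: "bij_betw (g(a := v)) (pverts U) (pverts ?H)"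
    using U(2) T(2,3) by (simp add: insert_absorb insert_Diff_if) (metis)
  have aE: "(a, t) \<in> parcs U \<longleftrightarrow> g t \<in> E" if t: "t \<in> pverts U" "t \<noteq> a" for t
  proof
    assume "g t \<in> E"
    then obtain z where z: "(a, z) \<in> parcs U" "g t = g z" using E by auto
    then have "z \<in> pverts U - {a}" using pair_graph_parcsD[OF U(1) z(1)] by auto
    then have "t = z" using z(2) t bij_betw_imp_inj_on[OF gb] by (auto dest: inj_onD)
    with z show "(a, t) \<in> parcs U" by simp
  qed (use E in auto)
  \<comment> \<open>Deleting \<open>b\<close> therefore removes no edge at \<open>v\<close>.\<close>
  have Eg: "E \<subseteq> pverts T - {b}"
  proof -
    have "{z. (a, z) \<in> parcs U} \<subseteq> pverts U - {a}" using pair_graph_parcsD[OF U(1)] by blast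
    then show ?thesis using image_mono[of _ _ g] E bij_betw_imp_surj_on[OF gb] by metis
  qed
  have "(s, t) \<in> parcs U \<longleftrightarrow> ((g(a := v)) s, (g(a := v)) t) \<in> parcs ?H"
    if st: "s \<in> pverts U" "t \<in> pverts U" for s t
  proof -
    consider "s = a" "t = a" | "s = a" "t \<noteq> a" | "s \<noteq> a" "t = a" | "s \<noteq> a" "t \<noteq> a" by blast
    then show ?thesis
    proof cases
      case 1
      then show ?thesis
        using pair_graph_parcsD[OF U(1), of a a] pair_graph_parcsD[OF T(1), of v v] T(2) Eg
        by (auto simp: parcs_attach)
    next
      case 2
      have "(v, g t) \<in> parcs ?H \<longleftrightarrow> g t \<in> E"
        using gin[OF st(2) 2(2)] T(2,3) pair_graph_parcsD[OF T(1), of v "g t"] by (auto simp: parcs_attach)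
      then show ?thesis using aE[OF st(2) 2(2)] 2 by simp
    next
      case 3
      have "(s, a) \<in> parcs U \<longleftrightarrow> (a, s) \<in> parcs U" using pair_graph_parcsD(3)[OF U(1)] by blast
      moreover have "(g s, v) \<in> parcs ?H \<longleftrightarrow> g s \<in> E"
        using gin[OF st(1) 3(1)] T(2,3) pair_graph_parcsD[OF T(1), of "g s" v] by (auto simp: parcs_attach)
      ultimately show ?thesis using aE[OF st(1) 3(1)] 3 by simp
    next
      case 4
      then show ?thesis
        using garc[of s t] st gin[OF st(1) 4(1)] gin[OF st(2) 4(2)] by (auto simp: parcs_attach)
    qed
  qed
  with bij show ?thesis by (simp add: is_isomorphism_def)
qed

text \<open>Joining \<open>v\<close> to both ends of the subpath from \<open>p (1 - i)\<close> to
  \<open>p (m - i)\<close> closes it to a cycle with \<open>m + 1\<close> vertices. The bounds on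
  \<open>m - i\<close> let the subpath contain the skeleton, so everything else stays a leaf. In
  \<open>X\<close>, the difference \<open>t - i\<close> does not truncate, because
  \<open>i \<le> 1\<close> and \<open>t\<close> is positive.\<close>

lemma attach_spine_cycle:
  assumes T: "pair_graph T" "spine T k p" and v: "v \<notin> pverts T"
    and i: "i \<le> 1" and m: "2 \<le> m" "k \<le> m - i" "m - i \<le> Suc k"
  defines "G \<equiv> attach T v {p (1 - i), p (m - i)}"
    and "S \<equiv> insert v (p ` {1 - i..m - i})"
    and "X \<equiv> \<lambda>t. if t = 0 then v else p (t - i)"
  shows "pendants G S" and "cycle_labelling (induced G S) (Suc m) X"
proof -
  note arc = spineD(5)[OF T(2)] and eq = spineD(6)[OF T(2)] and pin = spineD(3)[OF T(2)]
  have pv: "p j \<noteq> v" "v \<noteq> p j" if "j \<le> Suc k" for j using pin[OF that] v by auto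
  have sub: "p ` {1..k} \<subseteq> S" using i m by (auto simp: S_def)
  show "pendants G S"
    unfolding pendants_def
  proof (intro conjI ballI)
    show "S \<subseteq> pverts G" using m(3) pin by (auto simp: S_def G_def)
    fix x assume x: "x \<in> pverts G - S"
    then have xT: "x \<in> pverts T" "x \<notin> p ` {1..k}" "x \<noteq> v" using sub by (auto simp: G_def S_def)
    obtain s where s: "s \<in> p ` {1..k}" "\<And>z. (x, z) \<in> parcs T \<longleftrightarrow> z = s"
      using pendants_leaf[OF spineD(4)[OF T(2)] xT(1,2)] by metis
    have "p (1 - i) \<in> S" "p (m - i) \<in> S" using i m by (auto simp: S_def)
    then have "x \<noteq> p (1 - i)" "x \<noteq> p (m - i)" using x by auto
    then have "(x, z) \<in> parcs G \<longleftrightarrow> z = s" for z using s(2) xT(3) by (auto simp: G_def parcs_attach)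
    then show "\<exists>s\<in>S. \<forall>z. (x, z) \<in> parcs G \<longleftrightarrow> z = s" using s(1) sub by blast
  qed
  have Xin: "X t \<in> S" if "t < Suc m" for t
  proof (cases "t = 0")
    case False
    then have "t - i \<in> {1 - i..m - i}" using that by auto
    with False show ?thesis by (simp add: X_def S_def)
  qed (simp add: X_def S_def)
  have Xeq: "X s = X t \<longleftrightarrow> s = t" if "s < Suc m" "t < Suc m" for s t
    using that i m pv[of "s - i"] pv[of "t - i"] eq[of "s - i" "t - i"] by (auto simp: X_def)
  have "X ` {..<Suc m} = S"
  proof
    show "S \<subseteq> X ` {..<Suc m}"
    proof
      fix x assume "x \<in> S"
      then consider "x = v" | j where "1 - i \<le> j" "j \<le> m - i" "x = p j" by (auto simp: S_def)
      then show "x \<in> X ` {..<Suc m}"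
      proof cases
        case 1
        then show ?thesis by (intro image_eqI[of _ _ 0]) (auto simp: X_def)
      next
        case 2
        then show ?thesis using i m by (intro image_eqI[of _ _ "j + i"]) (auto simp: X_def)
      qed
    qed
  qed (use Xin in auto)
  moreover have "inj_on X {..<Suc m}" by (rule inj_onI) (use Xeq in auto)
  ultimately have bij: "bij_betw X {..<Suc m} S" by (simp add: bij_betw_def)
  have mod: "(s + 1) mod Suc m = (if s = m then 0 else Suc s)" if "s < Suc m" for s
    using that by (auto intro: mod_less)
  have Xarc: "(X s, X t) \<in> parcs G \<longleftrightarrow> t = (s + 1) mod Suc m \<or> s = (t + 1) mod Suc m"
    if s: "s < Suc m" and t: "t < Suc m" for s t
  proof -
    have vT: "(v, z) \<notin> parcs T" "(z, v) \<notin> parcs T" for z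
      using pair_graph_parcsD[OF T(1)] v by blast+
    have pE: "p j \<in> {p (1 - i), p (m - i)} \<longleftrightarrow> j = 1 - i \<or> j = m - i" if "j \<le> Suc k" for j
      using that eq[of j "1 - i"] eq[of j "m - i"] i m by auto
    have Ev: "v \<notin> {p (1 - i), p (m - i)}" using pv[of "1 - i"] pv[of "m - i"] m by auto
    consider "s = 0" "t = 0" | "s = 0" "0 < t" | "0 < s" "t = 0" | "0 < s" "0 < t" by blast
    then show ?thesis
    proof cases
      case 1
      then show ?thesis using vT Ev m(1) by (auto simp: X_def G_def parcs_attach)
    next
      case 2
      then have "(X s, X t) \<in> parcs G \<longleftrightarrow> p (t - i) \<in> {p (1 - i), p (m - i)}"
        using vT Ev by (auto simp: X_def G_def parcs_attach)
      also have "\<dots> \<longleftrightarrow> t = 1 \<or> t = m" using pE[of "t - i"] 2 i m t by auto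
      finally show ?thesis using 2 m mod[OF s] mod[OF t] by auto
    next
      case 3
      then have "(X s, X t) \<in> parcs G \<longleftrightarrow> p (s - i) \<in> {p (1 - i), p (m - i)}"
        using vT Ev by (auto simp: X_def G_def parcs_attach)
      also have "\<dots> \<longleftrightarrow> s = 1 \<or> s = m" using pE[of "s - i"] 3 i m s by auto
      finally show ?thesis using 3 m mod[OF s] mod[OF t] by auto
    next
      case 4
      have le: "s - i \<le> Suc k" "t - i \<le> Suc k" using s t m by auto
      have "(X s, X t) \<in> parcs G \<longleftrightarrow> (p (s - i), p (t - i)) \<in> parcs T"
        using 4 pv le by (auto simp: X_def G_def parcs_attach)
      also have "\<dots> \<longleftrightarrow> t - i = Suc (s - i) \<or> s - i = Suc (t - i)" using arc le by blast
      also have "\<dots> \<longleftrightarrow> t = Suc s \<or> s = Suc t" using 4 i by auto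
      finally show ?thesis using 4 m mod[OF s] mod[OF t] s t by auto
    qed
  qed
  have "parcs (induced G S) =
    {(X s, X t) | s t. s < Suc m \<and> t < Suc m \<and> (t = (s + 1) mod Suc m \<or> s = (t + 1) mod Suc m)}"
    (is "?L = ?R")
  proof
    show "?L \<subseteq> ?R"
    proof
      fix x assume x: "x \<in> ?L"
      obtain x1 x2 where x12: "x = (x1, x2)" by (cases x)
      then have "x1 \<in> X ` {..<Suc m}" "x2 \<in> X ` {..<Suc m}" "(x1, x2) \<in> parcs G"
        using x bij_betw_imp_surj_on[OF bij] by auto
      then obtain s t where st: "s < Suc m" "t < Suc m" "x1 = X s" "x2 = X t" "(X s, X t) \<in> parcs G"
        by (metis imageE lessThan_iff)
      then show "x \<in> ?R" using Xarc[OF st(1,2)] x12 by blast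
    qed
    show "?R \<subseteq> ?L"
    proof
      fix x assume "x \<in> ?R"
      then obtain s t where st: "x = (X s, X t)" "s < Suc m" "t < Suc m"
        "t = (s + 1) mod Suc m \<or> s = (t + 1) mod Suc m" by blast
      then have "(X s, X t) \<in> parcs G" using Xarc[OF st(2,3)] by blast
      then show "x \<in> ?L" using st(1) Xin[OF st(2)] Xin[OF st(3)] by simp
    qed
  qed
  then show "cycle_labelling (induced G S) (Suc m) X"
    using bij m(1) by (simp add: cycle_labelling_def)
qed

text \<open>Being off the cycle, \<open>w\<close> is a leaf; its neighbour becomes
  \<open>x 0\<close>, and the required order of degrees around \<open>v\<close> comes from
  \<open>cycle_labelling_mark\<close>.\<close>

lemma marked_sunshine_supercardI:
  assumes G: "pair_graph G" "pendants G S" "cycle_labelling (induced G S) c y" "card (pverts G) = n + 1"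
    and v: "v \<in> S" and w: "w \<in> pverts G" "w \<notin> S"
    and U: "pair_graph U" "isomorphic (G \<ominus> w) U" and T: "pair_graph T" "isomorphic (G \<ominus> v) T"
  shows "\<exists>x \<nu>. marked_sunshine_supercard n U T G w v c x \<nu>"
proof -
  have sk: "skeleton G = induced G S" using skeleton_eq_inducedI[OF G(1-3)] .
  have vG: "v \<in> pverts G" using v G(2) by (auto simp: pendants_def)
  obtain s where s: "s \<in> S" "(w, s) \<in> parcs G" using pendants_leaf[OF G(2) w] by metis
  from cycle_labelling_mark[OF G(3), of s v "degree G"] s(1) v
  obtain x \<nu> where x: "cycle_labelling (induced G S) c x" "x 0 = s" "\<nu> < c" "v = x \<nu>"
    "degree G (x ((\<nu> + c - 1) mod c)) \<ge> degree G (x ((\<nu> + 1) mod c))"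
    by auto
  have "unlabelled (G \<ominus> w) = unlabelled U"
    using pair_graph_wf[OF pair_graph_del[OF G(1)]] pair_graph_wf[OF U(1)] U(2) by (rule unlabelled_eqI)
  moreover have "unlabelled (G \<ominus> v) = unlabelled T"
    using pair_graph_wf[OF pair_graph_del[OF G(1)]] pair_graph_wf[OF T(1)] T(2) by (rule unlabelled_eqI)
  moreover have "unlabelled (G \<ominus> z) \<in># deck G" if "z \<in> pverts G" for z
    using that G(1) by (simp add: deck_def pair_graph_iff)
  ultimately have "unlabelled U \<in># deck G" "unlabelled T \<in># deck G" using w(1) vG by metis+
  then have "supercard n U T G" using G(1,4) by (simp add: supercard_def)
  moreover have "(s, w) \<in> parcs G" using pair_graph_parcsD(3)[OF G(1) s(2)] .
  ultimately show ?thesis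
    using sunshineI[OF G(1-3)] w(1) U(2) vG T(2) x sk
    unfolding marked_sunshine_supercard_def by metis
qed

section \<open>The bound on the number of common cards\<close>

theorem theorem3p23:
  fixes U :: "'a ugraph" and T :: "'b ugraph" and G :: "'c ugraph"
    and n c \<nu> :: nat and w v :: 'c and x :: "nat \<Rightarrow> 'c"
  assumes "sunshine U" and "card (pverts U) = n"
    and "caterpillar T" and "card (pverts T) = n"
    and "common_cards U T \<ge> 5"
    and "marked_sunshine_supercard n U T G w v c x \<nu>"
    and "\<And>G' w' v' c' x' \<nu>'.
           marked_sunshine_supercard n U T (G' :: 'c ugraph) w' v' c' x' \<nu>' \<Longrightarrow>
           chi G' w' v' \<le> chi G w v"
  shows "common_cards U T \<le> 2 * chi G w v + 5"
proof (cases "common_cards U T \<le> 5")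
  \<comment> \<open>There are now at least six common cards, so pairs remain after at most four are
    excluded.\<close>
  case False
  obtain S l y where U: "pair_graph U" "pendants U S" "cycle_labelling (induced U S) l y"
    using sunshineD[OF assms(1)] by blast
  obtain k p where p: "spine T k p" using caterpillar_spine[OF assms(3)] by blast
  have T: "pair_graph T" using assms(3) by (simp add: caterpillar_def)
  have G: "pair_graph G" "card (pverts G) = n + 1" "v \<in> pverts G" "isomorphic (G \<ominus> v) T"
    using assms(6) by (auto simp: marked_sunshine_supercard_def supercard_def)
  \<comment> \<open>The maximality of \<open>chi G w v\<close> concerns supercards over the vertex
    type of \<open>G\<close>. So \<open>T\<close> is replaced by its copy in \<open>G\<close>, and
    \<open>v\<close> is available as the new vertex.\<close>
  define T' where "T' = G \<ominus> v"
  have T': "pair_graph T'" "v \<notin> pverts T'" "insert v (pverts T') = pverts G"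
    using G(1,3) by (auto simp: T'_def pair_graph_del)
  obtain g where g: "is_isomorphism g T T'"
    using isomorphic_sym_iff[of T' T] T'(1) T G(4) unfolding T'_def by blast
  define P where "P = g \<circ> p"
  have P: "spine T' k P"
    unfolding P_def using p g pair_graph_wf[OF T] pair_graph_wf[OF T'(1)] by (rule spine_iso)
  obtain A h0 where A: "A \<subseteq> pverts U" "inj_on h0 A" "h0 ` A \<subseteq> pverts T" "card A = common_cards U T"
    and h0: "\<forall>a\<in>A. \<exists>f. is_isomorphism f (U \<ominus> a) (T \<ominus> h0 a)"
    using common_cards_matching[OF U(1) T] by blast
  define h where "h = g \<circ> h0"
  have finA: "finite A" using A(1) U(1) finite_subset by (auto simp: pair_graph_iff)
  have gbij: "inj_on g (pverts T)" "g ` pverts T = pverts T'"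
    using g by (auto simp: is_isomorphism_def bij_betw_def)
  have hinj: "inj_on h A" unfolding h_def using A(2,3) gbij(1) by (metis comp_inj_on inj_on_subset)
  have hin: "h a \<in> pverts T'" if "a \<in> A" for a using that A(3) gbij(2) by (auto simp: h_def)
  \<comment> \<open>The vertices excluded in \<open>card_iso_normal_form\<close>. Some coincide if
    \<open>k = 1\<close>, so their number is only bounded by 4.\<close>
  define N where "N = {P 0, P 1, P k, P (Suc k)}"
  define A' where "A' = {a \<in> A. h a \<notin> N}"
  have "card {a \<in> A. h a \<in> N} \<le> card N"
    by (rule card_inj_on_le[of h]) (use hinj in \<open>auto simp: N_def inj_on_def\<close>)
  also have "\<dots> \<le> 4" using card_length[of "[P 0, P 1, P k, P (Suc k)]"] by (simp add: N_def)
  finally have "card {a \<in> A. h a \<in> N} \<le> 4" .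
  moreover have "card A = card {a \<in> A. h a \<in> N} + card A'"
    unfolding A'_def using finA by (subst card_Un_disjoint[symmetric]) (auto intro: arg_cong[where f = card])
  ultimately have cardA': "card A \<le> card A' + 4" by simp
  \<comment> \<open>The number of cycle vertices of \<open>U\<close> left after deleting one of
    them.\<close>
  define m where "m = l - 1"
  have m: "2 \<le> m" using cycle_labelling_inducedD(1)[OF U(3)] by (simp add: m_def)
  have "\<exists>f i. is_isomorphism f (U \<ominus> a) (T' \<ominus> h a) \<and> i \<le> 1 \<and> k \<le> m - i \<and> m - i \<le> Suc k \<and>
      f ` {z. (a, z) \<in> parcs U} = {P (1 - i), P (m - i)} \<and> h a \<notin> P ` {..Suc k}"
    if a: "a \<in> A'" for a
  proof -
    have a': "a \<in> A" "h a \<notin> {P 0, P 1, P k, P (Suc k)}" using a by (auto simp: A'_def N_def)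
    obtain f where f: "is_isomorphism f (U \<ominus> a) (T \<ominus> h0 a)" using h0 a'(1) by blast
    have "is_isomorphism g (T \<ominus> h0 a) (T' \<ominus> h a)"
      using is_isomorphism_del[OF g, of "h0 a"] A(3) a'(1) by (auto simp: h_def)
    with f have "is_isomorphism (g \<circ> f) (U \<ominus> a) (T' \<ominus> h a)" by (rule is_isomorphism_comp)
    moreover have "a \<in> pverts U" using A(1) a'(1) by blast
    ultimately show ?thesis
      using card_iso_normal_form[OF U T'(1) P _ _ a'(2)] unfolding m_def by metis
  qed
  then obtain f i where f: "\<And>a. a \<in> A' \<Longrightarrow> is_isomorphism (f a) (U \<ominus> a) (T' \<ominus> h a)"
    and i: "\<And>a. a \<in> A' \<Longrightarrow> i a \<le> 1 \<and> k \<le> m - i a \<and> m - i a \<le> Suc k"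
    and fE: "\<And>a. a \<in> A' \<Longrightarrow> f a ` {z. (a, z) \<in> parcs U} = {P (1 - i a), P (m - i a)}"
    and hP: "\<And>a. a \<in> A' \<Longrightarrow> h a \<notin> P ` {..Suc k}"
    by metis
  \<comment> \<open>The pairs are split by the position of the opened cycle along the spine; the
    larger class holds at least half of \<open>A'\<close>.\<close>
  define B where "B r = {a \<in> A'. i a = r}" for r
  have "A' = B 0 \<union> B 1" using i by (force simp: B_def)
  then have "card A' \<le> card (B 0) + card (B 1)" by (simp add: card_Un_le)
  then have "card A' \<le> 2 * card (B 0) \<or> card A' \<le> 2 * card (B 1)" by linarith
  then obtain r where r: "card A' \<le> 2 * card (B r)" by blast
  \<comment> \<open>At least two pairs are left in \<open>A'\<close>, so the larger class is
    nonempty and supplies \<open>a0\<close>.\<close>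
  have "card (B r) \<noteq> 0" using r cardA' A(4) False by auto
  then obtain a0 where a0: "a0 \<in> B r" by (metis card.empty ex_in_conv)
  then have a0': "a0 \<in> A'" "i a0 = r" by (auto simp: B_def)
  have ri: "r \<le> 1" "k \<le> m - r" "m - r \<le> Suc k" using i[OF a0'(1)] a0'(2) by auto
  \<comment> \<open>These ends depend only on the class, so a single graph \<open>G'\<close> serves
    all its pairs.\<close>
  define E where "E = {P (1 - r), P (m - r)}"
  define G' where "G' = attach T' v E"
  have E: "E \<subseteq> pverts T'" using ri spineD(3)[OF P] by (auto simp: E_def)
  have G': "pair_graph G'" unfolding G'_def using T'(1) E T'(2) by (rule pair_graph_attach)
  have G'v: "G' \<ominus> v = G \<ominus> v" unfolding G'_def using attach_del[OF T'(1,2)] by (simp add: T'_def)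
  have pv: "pverts G' = pverts G" using T'(3) by (simp add: G'_def)
  define F where "F a = (f a)(a := v)" for a
  have B: "B r \<subseteq> A" by (auto simp: B_def A'_def)
  have F: "is_isomorphism (F a) U (G' \<ominus> h a)" if a: "a \<in> B r" for a
  proof -
    have "a \<in> pverts U" "h a \<in> pverts T'" using a B A(1) hin by auto
    moreover have "is_isomorphism (f a) (U \<ominus> a) (T' \<ominus> h a)" "f a ` {z. (a, z) \<in> parcs U} = E"
      using a f fE by (auto simp: B_def E_def)
    ultimately show ?thesis
      unfolding F_def G'_def using is_isomorphism_attach[OF U(1) _ T'(1,2)] by blast
  qed
  have "card (B r) \<le> chi G' (h a0) v"
  proof (rule card_le_chi_if_isos)
    show "finite (pverts G')" using G' by (simp add: pair_graph_iff)
    show "v \<in> pverts G'" using pv G(3) by simp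
    show "B r \<subseteq> pverts U" "a0 \<in> B r" using B A(1) a0 by auto
    show "inj_on h (B r)" using hinj B by (rule inj_on_subset)
    show "h a \<in> pverts G'" if "a \<in> B r" for a using that B hin by (auto simp: G'_def)
    show "is_isomorphism (F a) U (G' \<ominus> h a)" if "a \<in> B r" for a using F[OF that] .
    show "F a a = v" for a by (simp add: F_def)
  qed
  also have "\<dots> \<le> chi G w v"
  proof -
    \<comment> \<open>The new cycle. It avoids \<open>h a0\<close>, which is off the whole spine, so
      \<open>G'\<close> with \<open>h a0\<close> and \<open>v\<close> is a marked sunshine supercard
      and the maximality of \<open>chi G w v\<close> applies.\<close>
    define R where "R = insert v (P ` {1 - r..m - r})"
    note cyc = attach_spine_cycle[OF T'(1) P T'(2) ri(1) m ri(2,3), folded E_def, folded G'_def, folded R_def]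
    have hT: "h a0 \<in> pverts T'" using a0 B hin by auto
    then have "h a0 \<in> pverts G'" by (simp add: G'_def)
    moreover have "P ` {1 - r..m - r} \<subseteq> P ` {..Suc k}" using ri(3) by auto
    then have "h a0 \<notin> R" using hP[OF a0'(1)] hT T'(2) by (auto simp: R_def)
    moreover have "isomorphic (G' \<ominus> h a0) U"
      using isomorphic_sym_iff[OF pair_graph_del[OF G'] U(1)] F[OF a0] by blast
    moreover have "card (pverts G') = n + 1" "isomorphic (G' \<ominus> v) T" using pv G(2,4) G'v by simp_all
    moreover have "v \<in> R" by (simp add: R_def)
    ultimately obtain x' \<nu>' where "marked_sunshine_supercard n U T G' (h a0) v (Suc m) x' \<nu>'"
      using marked_sunshine_supercardI[OF G' cyc] U(1) T by blast
    then show ?thesis by (rule assms(7))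
  qed
  \<comment> \<open>In total, \<open>card A \<le> card A' + 4\<close> and
    \<open>card A' \<le> 2 * card (B r)\<close>, where
    \<open>card (B r) \<le> chi G w v\<close>.\<close>
  finally show ?thesis using r cardA' A(4) by simp
qed simp

end
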